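(* Let $j\ge 0$ be an integer, let $V(\cdot;j)\in\mathcal{A}$ and $\theta_j\in(0,\pi]$, let $b\ge 0$ be such that $V(x;j)=0$ for $x>b$, and suppose the Schrödinger operator with potential $V(\cdot;j)$ and boundary parameter $\theta_j$ has its bound states exactly at $k=i\gamma_s$, $s=1,\dots,j$ (none if $j=0$). Let $F(k;0)$ be the Jost function of the pair $\{V(\cdot;0),\theta_0\}$ obtained from $\{V(\cdot;j),\theta_j\}$ by removing all its bound states, and let $H(\beta;0)$, $\beta\in\mathbb{R}$, be defined by $H(\beta;0)=-i\,F(i\beta;0)$ if $\theta_0\in(0,\pi)$ and $H(\beta;0)=F(i\beta;0)$ if $\theta_0=\pi$. Let $\gamma_{j+1}>0$ be different from $\gamma_1,\dots,\gamma_j$. Then a bound state at $k=i\gamma_{j+1}$ can be added to $\{V(\cdot;j),\theta_j\}$ (with a suitable Gel'fand–Levitan norming constant $g_{j+1}>0$) in such a way that the support of the resulting potential $V(\cdot;j+1)$ is also confined to $(0,b)$ if and only if $$H(-\gamma_{j+1};0)=0,\qquad H'(-\gamma_{j+1};0)>0.$$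
   Context: The class $\mathcal{A}$ consists of real-valued integrable potentials $V$ on $\mathbb{R}^+=(0,\infty)$ for which there is $b\ge0$ with $V(x)=0$ for $x>b$ (a.e. identification). The Schrödinger operator with potential $V$ and boundary parameter $\theta\in(0,\pi]$ is given by $-\psi''+V\psi=k^2\psi$ on $\mathbb{R}^+$ with $(\sin\theta)\psi'(0)+(\cos\theta)\psi(0)=0$. Jost solution: $f(k,x)$ with $f(k,x)=e^{ikx}$ for $x\ge b$. Jost function: $F(k)=-i[f'(k,0)+\cot\theta\,f(k,0)]$ if $\theta\in(0,\pi)$, $F(k)=f(k,0)$ if $\theta=\pi$; it is entire in $k$, and the bound states are its zeros in the open upper half-plane, which are simple and lie on the positive imaginary axis. Regular solution: $\varphi(k,0)=1$, $\varphi'(k,0)=-\cot\theta$ if $\theta\in(0,\pi)$; $\varphi(k,0)=0$, $\varphi'(k,0)=1$ if $\theta=\pi$. The quantities for $\{V(\cdot;s),\theta_s\}$ are written $F(k;s)$, $\varphi(k,x;s)$. $H'(\beta;0)=dH(\beta;0)/d\beta$. Adding a bound state at $k=i\gamma_{j+1}$ with norming constant $g_{j+1}>0$ means passing, by the Darboux transformation, to $$V(x;j+1)=V(x;j)-\frac{d}{dx}\left[\frac{2g_{j+1}^2\,\varphi(i\gamma_{j+1},x;j)^2}{1+g_{j+1}^2\int_0^x\varphi(i\gamma_{j+1},y;j)^2dy}\right]$$ with $\cot\theta_{j+1}=\cot\theta_j+g_{j+1}^2$ if $\theta_j\in(0,\pi)$ and $\theta_{j+1}=\pi$ if $\theta_j=\pi$.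 Removing the bound state at $k=i\gamma_s$ from $\{V(\cdot;s),\theta_s\}$ (which has bound states at $i\gamma_1,\dots,i\gamma_s$), with norming constant $g_s=\left(\int_0^\infty\varphi(i\gamma_s,x;s)^2dx\right)^{-1/2}$, means passing to $$V(x;s-1)=V(x;s)+\frac{d}{dx}\left[\frac{2g_s^2\,\varphi(i\gamma_s,x;s)^2}{1-g_s^2\int_0^x\varphi(i\gamma_s,y;s)^2dy}\right]$$ with $\cot\theta_{s-1}=\cot\theta_s-g_s^2$ if $\theta_s\in(0,\pi)$ and $\theta_{s-1}=\pi$ if $\theta_s=\pi$; the Jost function transforms as $F(k;s-1)=\frac{k+i\gamma_s}{k-i\gamma_s}F(k;s)$. The pair $\{V(\cdot;0),\theta_0\}$ results from doing this successively for $s=j,j-1,\dots,1$. "Support confined to $(0,b)$" means $V(x;j+1)=0$ for (almost every) $x>b$. *)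

theory Defs
  imports "HOL-Analysis.Analysis"
begin

text \<open>
  The half-line is \<open>(0, \<infinity>)\<close>.  Potentials are functions on \<open>\<real>\<close> whose values at \<open>x \<le> 0\<close> are never
  used (up to the null set \<open>{0}\<close>), and they matter only up to equality almost everywhere.  Integrability is
  in the sense of Lebesgue (\<open>absolutely_integrable_on\<close>).
\<close>

definition vanishes_beyond :: "(real \<Rightarrow> real) \<Rightarrow> real \<Rightarrow> bool" where
  "vanishes_beyond V b \<longleftrightarrow> (AE x in lebesgue. b < x \<longrightarrow> V x = 0)"

definition class_A :: "(real \<Rightarrow> real) set" where
  "class_A = {V. V absolutely_integrable_on {0<..} \<and> (\<exists>b\<ge>0. vanishes_beyond V b)}"

text \<open>Derivative on the closed half-line; at \<open>0\<close> it is the right-hand derivative.\<close>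

abbreviation deriv0 :: "(real \<Rightarrow> complex) \<Rightarrow> real \<Rightarrow> complex" where
  "deriv0 \<psi> x \<equiv> vector_derivative \<psi> (at x within {0..})"

text \<open>
  For a merely integrable \<open>V\<close>, a solution of \<open>-\<psi>'' + V \<psi> = k\<^sup>2 \<psi>\<close> is a differentiable \<open>\<psi>\<close> whose derivative
  is locally absolutely continuous on \<open>[0, \<infinity>)\<close> and which satisfies the equation almost everywhere,
  i.e. \<open>\<psi>'\<close> is the indefinite integral of \<open>(V - k\<^sup>2) \<psi>\<close>.
\<close>

definition schroedinger_solution :: "(real \<Rightarrow> real) \<Rightarrow> complex \<Rightarrow> (real \<Rightarrow> complex) \<Rightarrow> bool" where
  "schroedinger_solution V k \<psi> \<longleftrightarrow>
     (\<forall>x\<ge>0. \<psi> differentiable (at x within {0..})) \<and>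
     (\<forall>x\<ge>0. deriv0 \<psi> x = deriv0 \<psi> 0 + integral {0..x} (\<lambda>t. (of_real (V t) - k\<^sup>2) * \<psi> t))"

text \<open>
  The Jost and the regular solution are uniquely determined on \<open>[0, \<infinity>)\<close>, so the choice below
  concerns only their irrelevant values at negative arguments.
\<close>

definition jost_solution :: "(real \<Rightarrow> real) \<Rightarrow> complex \<Rightarrow> real \<Rightarrow> complex" where
  "jost_solution V k = (SOME f. schroedinger_solution V k f \<and>
     (\<exists>b\<ge>0. vanishes_beyond V b \<and> (\<forall>x\<ge>b. f x = exp (\<i> * k * of_real x))))"

definition regular_solution :: "(real \<Rightarrow> real) \<Rightarrow> real \<Rightarrow> complex \<Rightarrow> real \<Rightarrow> complex" where
  "regular_solution V \<theta> k = (SOME \<phi>. schroedinger_solution V k \<phi> \<and>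
     (if \<theta> = pi then \<phi> 0 = 0 \<and> deriv0 \<phi> 0 = 1
      else \<phi> 0 = 1 \<and> deriv0 \<phi> 0 = - of_real (cot \<theta>)))"

definition jost_function :: "(real \<Rightarrow> real) \<Rightarrow> real \<Rightarrow> complex \<Rightarrow> complex" where
  "jost_function V \<theta> k =
     (if \<theta> = pi then jost_solution V k 0
      else - \<i> * (deriv0 (jost_solution V k) 0 + of_real (cot \<theta>) * jost_solution V k 0))"

definition bound_states :: "(real \<Rightarrow> real) \<Rightarrow> real \<Rightarrow> complex set" where
  "bound_states V \<theta> = {k. 0 < Im k \<and> jost_function V \<theta> k = 0}"

definition jost_H :: "(real \<Rightarrow> real) \<Rightarrow> real \<Rightarrow> real \<Rightarrow> complex" where
  "jost_H V \<theta> \<beta> =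
     (if \<theta> = pi then jost_function V \<theta> (\<i> * of_real \<beta>)
      else - \<i> * jost_function V \<theta> (\<i> * of_real \<beta>))"

text \<open>
  \<open>\<phi>(i\<gamma>, x)\<close> for \<open>x \<ge> 0\<close> and real \<open>\<gamma>\<close>.  It is real, because \<open>(i\<gamma>)\<^sup>2 = -\<gamma>\<^sup>2\<close> and \<open>V\<close> are real; taking the
  real part only changes its type.
\<close>

definition phi :: "(real \<Rightarrow> real) \<Rightarrow> real \<Rightarrow> real \<Rightarrow> real \<Rightarrow> real" where
  "phi V \<theta> \<gamma> x = Re (regular_solution V \<theta> (\<i> * of_real \<gamma>) x)"

text \<open>
  The boundary parameter \<open>\<theta>'\<close> with \<open>cot \<theta>' = cot \<theta> + c\<close> in \<open>(0, \<pi>)\<close>; the Dirichlet value \<open>\<pi>\<close> is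
  kept.
\<close>

definition shift_boundary :: "real \<Rightarrow> real \<Rightarrow> real" where
  "shift_boundary c \<theta> =
     (if \<theta> = pi then pi else (THE \<theta>'. 0 < \<theta>' \<and> \<theta>' < pi \<and> cot \<theta>' = cot \<theta> + c))"

type_synonym schroedinger_data = "(real \<Rightarrow> real) \<times> real"

definition add_bound_state :: "real \<Rightarrow> real \<Rightarrow> schroedinger_data \<Rightarrow> schroedinger_data" where
  "add_bound_state \<gamma> g = (\<lambda>(V, \<theta>).
     (\<lambda>x. V x - deriv (\<lambda>x. 2 * g\<^sup>2 * (phi V \<theta> \<gamma> x)\<^sup>2 /
                            (1 + g\<^sup>2 * integral {0..x} (\<lambda>y. (phi V \<theta> \<gamma> y)\<^sup>2))) x,
      shift_boundary (g\<^sup>2) \<theta>))"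

definition norming_constant :: "real \<Rightarrow> schroedinger_data \<Rightarrow> real" where
  "norming_constant \<gamma> = (\<lambda>(V, \<theta>). 1 / sqrt (integral {0..} (\<lambda>x. (phi V \<theta> \<gamma> x)\<^sup>2)))"

definition remove_bound_state :: "real \<Rightarrow> schroedinger_data \<Rightarrow> schroedinger_data" where
  "remove_bound_state \<gamma> = (\<lambda>(V, \<theta>). let g = norming_constant \<gamma> (V, \<theta>) in
     (\<lambda>x. V x + deriv (\<lambda>x. 2 * g\<^sup>2 * (phi V \<theta> \<gamma> x)\<^sup>2 /
                            (1 - g\<^sup>2 * integral {0..x} (\<lambda>y. (phi V \<theta> \<gamma> y)\<^sup>2))) x,
      shift_boundary (- (g\<^sup>2)) \<theta>))"

text \<open>Removes the bound states at \<open>i \<gamma> s\<close> successively for \<open>s = j, j - 1, \<dots>, 1\<close>.\<close>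

primrec remove_bound_states :: "(nat \<Rightarrow> real) \<Rightarrow> nat \<Rightarrow> schroedinger_data \<Rightarrow> schroedinger_data" where
  "remove_bound_states \<gamma> 0 D = D"
| "remove_bound_states \<gamma> (Suc s) D = remove_bound_states \<gamma> s (remove_bound_state (\<gamma> (Suc s)) D)"

end

theory Submission
  imports Defs
begin

text \<open>
  Only \<open>k = i\<beta>\<close> with real \<open>\<beta>\<close> matters, so everything is a real second-order equation.  A Wronskian gives
  \<open>H(\<beta>) = exp (- \<beta> b) (\<phi>'(b) + \<beta> \<phi>(b))\<close> for the regular solution \<open>\<phi>\<close> at \<open>i\<beta>\<close>, and, with \<open>\<kappa> = \<gamma> (j + 1)\<close>,
  the added bound state preserves the support iff \<open>\<phi>'(b) = \<kappa> \<phi>(b)\<close> and \<open>Q := \<phi>(b)\<^sup>2 - 2 \<kappa> \<integral>\<^sub>0\<^sup>b \<phi>\<^sup>2 > 0\<close>, where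
  \<open>\<phi>\<close> is taken at \<open>i\<kappa>\<close>.  The first condition says \<open>H(-\<kappa>; j) = 0\<close>, and then
  \<open>H'(-\<kappa>; j) = exp (\<kappa> b) Q / \<phi>(b)\<close> while \<open>H(\<kappa>; j) = 2 \<kappa> exp (- \<kappa> b) \<phi>(b)\<close>.  The Darboux transformations give
  \<open>H(\<beta>; 0) = P(\<beta>) H(\<beta>; j)\<close> with \<open>P(-\<kappa>) P(\<kappa>) = 1\<close>, so that \<open>H'(-\<kappa>; 0) H(\<kappa>; 0) = 2 \<kappa> Q\<close>; and \<open>H(\<kappa>; 0) > 0\<close>
  because \<open>H(\<beta>; 0)\<close> is continuous, positive for large \<open>\<beta>\<close> and without zeros on \<open>\<beta> > 0\<close>.
\<close>

section \<open>Linear ordinary differential equations on the half-line\<close>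

text \<open>Since \<open>V\<close> is merely integrable, the derivative of a solution is only
  absolutely continuous. All information on \<open>V\<close> is therefore routed through a primitive
  \<open>W\<close> that is continuous and vanishes beyond \<open>b\<close>. The partner of \<phi> in
  the Wronskian is the Jost solution, which is explicit beyond \<open>b\<close>. The equation sees
  \<beta> only through its square, so one and the same \<phi> serves at \<kappa> and at -\<kappa>,
  which is why \<open>H\<close> can be compared at these two points. The signs of \<phi>(b) and of
  P(-\<kappa>) are not known separately. Multiplying H'(-\<kappa>; 0) by H(\<kappa>; 0) removes
  both: \<phi>(b) cancels, and each factor of P at -\<kappa> is the reciprocal of the one at
  \<kappa>. The Darboux formula divides by the difference of the squares of \<beta> and \<gamma> and
  so says nothing at \<gamma> itself, whereas the sign argument must exclude zeros at every positive
  \<beta>. The value at \<gamma> is therefore recovered as a limit.\<close>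

lemma at_within_half_line_neq_bot: "0 \<le> x \<Longrightarrow> at x within {0..} \<noteq> bot" for x :: real
proof -
  assume "0 \<le> x"
  then have "{x<..<x+1} \<subseteq> {0..}" by auto
  then have "at x within {x<..<x+1} \<le> at x within {0..}" by (rule at_le)
  moreover have "at x within {x<..<x+1} \<noteq> bot"
    using at_within_eq_bot_iff islimpt_greaterThanLessThan1[of x "x+1"] trivial_limit_within by force
  ultimately show ?thesis using bot.extremum_uniqueI by metis
qed

lemma integral_has_vector_derivative_half_line:
  fixes f :: "real \<Rightarrow> 'a::banach"
  assumes "continuous_on {0..} f" "0 \<le> x"
  shows "((\<lambda>t. integral {0..t} f) has_vector_derivative f x) (at x within {0..})"
proof -
  have "continuous_on {0..x+1} f" using assms(1) by (rule continuous_on_subset) auto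
  then have "((\<lambda>t. integral {0..t} f) has_vector_derivative f x) (at x within {0..x+1})"
    using assms by (intro integral_has_vector_derivative) auto
  moreover have "at x within {0..x+1} = at x within {0..}"
    using assms(2) by (intro at_within_nhd[where S="{..<x+1}"]) auto
  ultimately show ?thesis by simp
qed

lemma continuous_on_extend_half_line:
  fixes f :: "real \<Rightarrow> 'a::topological_space"
  assumes "continuous_on {0..} f"
  shows "continuous_on UNIV (\<lambda>t. f (max 0 t))"
  by (rule continuous_on_compose2[OF assms]) (auto intro!: continuous_intros)

text \<open>Integrating the bound \<open>M * exp (L * s)\<close> produces the factor
  \<open>1 / L\<close>, which a large \<open>L\<close> makes small; this is what turns the Volterra
  operator into a contraction.\<close>

lemma exp_weighted_integral_bound:
  fixes f :: "real \<Rightarrow> 'a::banach"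
  assumes f: "continuous_on {0..} f" and L: "0 < L" and M: "0 \<le> M"
    and bound: "\<And>s. 0 \<le> s \<Longrightarrow> norm (f s) \<le> M * exp (L * s)" and t: "0 \<le> t"
  shows "norm (exp (- L * t) *\<^sub>R integral {0..t} f) \<le> M / L"
proof -
  have int: "((\<lambda>s. M * exp (L * s)) has_integral (M / L * exp (L * t) - M / L * exp (L * 0))) {0..t}"
    using t L by (intro fundamental_theorem_of_calculus)
      (auto simp flip: has_real_derivative_iff_has_vector_derivative intro!: derivative_eq_intros)
  have "norm (integral {0..t} f) \<le> integral {0..t} (\<lambda>s. M * exp (L * s))"
    using f bound int by (intro integral_norm_bound_integral)
      (auto intro!: integrable_continuous_real continuous_on_subset[OF f] continuous_intros)
  also have "\<dots> = M / L * exp (L * t) - M / L"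
    using integral_unique[OF int] by simp
  also have "\<dots> \<le> M / L * exp (L * t)" using L M by simp
  finally have "exp (- L * t) * norm (integral {0..t} f) \<le> exp (- L * t) * (M / L * exp (L * t))"
    by (rule mult_left_mono) simp
  also have "\<dots> = M / L"
    using exp_minus_inverse[of "L * t"] by (simp add: mult.left_commute mult.commute)
  finally show ?thesis by simp
qed

text \<open>
  Picard iteration in the supremum norm with weight \<open>exp (- L * t)\<close>, in which the Volterra operator
  is a contraction on the whole half-line.
\<close>

lemma lipschitz_ode_exists:
  fixes F :: "real \<Rightarrow> 'a::banach \<Rightarrow> 'a"
  assumes cont: "\<And>X. continuous_on {0..} X \<Longrightarrow> continuous_on {0..} (\<lambda>t. F t (X t))"
    and lip: "\<And>t u v. 0 \<le> t \<Longrightarrow> norm (F t u - F t v) \<le> K * norm (u - v)"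
    and zero: "\<And>t. 0 \<le> t \<Longrightarrow> F t 0 = 0"
    and K: "0 \<le> K"
  shows "\<exists>X. X 0 = x0 \<and> (\<forall>t\<ge>0. (X has_vector_derivative F t (X t)) (at t within {0..}))"
proof -
  \<comment> \<open>Then \<open>K / L\<close> is at most \<open>1/2\<close>, and \<open>L\<close>
    stays positive even for \<open>K = 0\<close>.\<close>
  define L where "L = 2 * K + 1"
  have L: "0 < L" using K by (simp add: L_def)
  define h :: "(real \<Rightarrow>\<^sub>C 'a) \<Rightarrow> real \<Rightarrow> 'a" where "h z s = F s (exp (L * s) *\<^sub>R z s)" for z s
  have h_cont: "continuous_on {0..} (h z)" for z
    unfolding h_def by (rule cont) (auto intro!: continuous_intros)
  define I where "I z t = integral {0..t} (h z)" for z t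
  \<comment> \<open>The unknown is \<open>z t = exp (- L * t) *\<^sub>R X t\<close>, which is
    bounded even if \<open>X\<close> grows. The bounded continuous functions live on the whole line,
    so \<open>max 0 t\<close> freezes everything at \<open>0\<close> for negative
    \<open>t\<close>.\<close>
  define G where "G z t = exp (- L * max 0 t) *\<^sub>R (x0 + I z (max 0 t))" for z t
  have I_der: "(I z has_vector_derivative h z t) (at t within {0..})" if "0 \<le> t" for z t
    unfolding I_def by (rule integral_has_vector_derivative_half_line[OF h_cont that])
  have I_cont: "continuous_on {0..} (I z)" for z
    using I_der by (metis atLeast_iff continuous_on_eq_continuous_within has_vector_derivative_continuous)
  have h_diff: "norm (h z s - h z' s) \<le> (K * dist z z') * exp (L * s)" if "0 \<le> s" for z z' s
  proof -
    have "norm (h z s - h z' s) \<le> K * norm (exp (L * s) *\<^sub>R z s - exp (L * s) *\<^sub>R z' s)"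
      unfolding h_def by (rule lip[OF that])
    also have "\<dots> = K * exp (L * s) * dist (z s) (z' s)"
      by (simp add: dist_norm flip: scaleR_diff_right)
    also have "\<dots> \<le> K * exp (L * s) * dist z z'"
      using K dist_bounded by (intro mult_left_mono) auto
    finally show ?thesis by (simp add: mult_ac)
  qed
  have diff: "norm (exp (- L * t) *\<^sub>R (I z t - I z' t)) \<le> K * dist z z' / L" if "0 \<le> t" for z z' t
  proof -
    have "I z t - I z' t = integral {0..t} (\<lambda>s. h z s - h z' s)"
      unfolding I_def using continuous_on_subset[OF h_cont]
      by (intro integral_diff[symmetric] integrable_continuous_real) auto
    then show ?thesis
      using exp_weighted_integral_bound[of "\<lambda>s. h z s - h z' s" L "K * dist z z'" t] that L K h_diff
      by (auto intro!: continuous_intros h_cont)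
  qed
  have I0: "I 0 t = 0" if "0 \<le> t" for t
    unfolding I_def h_def using zero by (intro integral_unique has_integral_is_0) auto
  \<comment> \<open>Boundedness comes from comparing \<open>z\<close> with the zero function, for
    which the integral term vanishes by \<open>I0\<close>.\<close>
  have G_bcont: "G z \<in> bcontfun" for z
  proof (rule bcontfun_normI)
    have "continuous_on {0..} (\<lambda>t. exp (- L * t) *\<^sub>R (x0 + I z t))"
      using I_cont[of z] by (auto intro!: continuous_intros)
    then show "continuous_on UNIV (G z)"
      unfolding G_def by (rule continuous_on_extend_half_line)
    fix t :: real
    define m where "m = max 0 t"
    have m: "0 \<le> m" by (simp add: m_def)
    have "norm (G z t) \<le> norm (exp (- L * m) *\<^sub>R x0) + norm (exp (- L * m) *\<^sub>R (I z m - I 0 m))"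
      unfolding G_def m_def[symmetric] I0[OF m] diff_0_right scaleR_add_right by (rule norm_triangle_ineq)
    also have "\<dots> \<le> norm x0 + K * dist z 0 / L"
      using diff[OF m, of z 0] m L
      by (intro add_mono) (simp_all add: mult_left_le_one_le)
    finally show "norm (G z t) \<le> norm x0 + K * dist z 0 / L" .
  qed
  define T where "T z = Bcontfun (G z)" for z
  have T: "apply_bcontfun (T z) = G z" for z
    unfolding T_def by (rule Bcontfun_inverse[OF G_bcont])
  have "dist (T z) (T z') \<le> 1/2 * dist z z'" for z z'
  proof (rule dist_bound)
    fix t :: real
    have "dist (T z t) (T z' t) = norm (exp (- L * max 0 t) *\<^sub>R (I z (max 0 t) - I z' (max 0 t)))"
      unfolding T G_def dist_norm by (simp add: algebra_simps)
    also have "\<dots> \<le> K / L * dist z z'" using diff[of "max 0 t" z z'] by simp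
    also have "\<dots> \<le> 1/2 * dist z z'"
      using K by (intro mult_right_mono) (simp_all add: L_def divide_le_eq)
    finally show "dist (T z t) (T z' t) \<le> 1/2 * dist z z'" .
  qed
  then obtain z where z: "T z = z"
    using banach_fix_type[of "1/2" T] by (simp add: Ex1_def) blast
  define X where "X t = x0 + I z t" for t
  have zX: "exp (L * t) *\<^sub>R z t = X t" if "0 \<le> t" for t
  proof -
    have "z t = G z t" using T[of z] unfolding z by (rule fun_cong)
    also have "\<dots> = exp (- (L * t)) *\<^sub>R X t" using that by (simp add: G_def X_def)
    finally show ?thesis by (simp only: scaleR_scaleR exp_minus_inverse scaleR_one)
  qed
  show ?thesis
  proof (intro exI[of _ X] conjI allI impI)
    show "X 0 = x0" by (simp add: X_def I_def)
    fix t :: real assume t: "0 \<le> t"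
    have "(X has_vector_derivative h z t) (at t within {0..})"
      unfolding X_def using has_vector_derivative_add[OF has_vector_derivative_const I_der[OF t]] by simp
    then show "(X has_vector_derivative F t (X t)) (at t within {0..})"
      unfolding h_def zX[OF t] .
  qed
qed

section \<open>The product rule for an absolutely continuous factor\<close>

text \<open>Dividing by \<open>t - s\<close> leaves \<open>K * \<bar>N t - N s\<bar>\<close>, which
  tends to zero by continuity of \<open>N\<close>. So \<open>N\<close> may be the integral of
  \<open>\<bar>V\<bar>\<close>, which can fail to be differentiable at some points.\<close>

lemma constant_if_small_increments:
  fixes \<Phi> N :: "real \<Rightarrow> real"
  assumes N: "continuous_on {0..R} N"
    and incr: "\<And>s t. 0 \<le> s \<Longrightarrow> s \<le> t \<Longrightarrow> t \<le> R \<Longrightarrow> \<bar>\<Phi> t - \<Phi> s\<bar> \<le> K * ((t - s) * \<bar>N t - N s\<bar>)"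
    and K: "0 \<le> K" and R: "0 \<le> R"
  shows "\<Phi> R = \<Phi> 0"
proof -
  have "(\<Phi> has_field_derivative 0) (at x within {0..R})" if x: "x \<in> {0..R}" for x
  proof -
    have "((\<lambda>y. K * \<bar>N y - N x\<bar>) \<longlongrightarrow> K * \<bar>N x - N x\<bar>) (at x within {0..R})"
      using N x by (intro tendsto_intros) (simp add: continuous_on_def)
    then have lim: "((\<lambda>y. K * \<bar>N y - N x\<bar>) \<longlongrightarrow> 0) (at x within {0..R})" by simp
    have "norm ((\<Phi> y - \<Phi> x) / (y - x)) \<le> K * \<bar>N y - N x\<bar>" if "y \<in> {0..R}" "y \<noteq> x" for y
    proof -
      have "\<bar>\<Phi> y - \<Phi> x\<bar> \<le> K * (\<bar>y - x\<bar> * \<bar>N y - N x\<bar>)"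
        using incr[of x y] incr[of y x] x that by (cases "x \<le> y") (auto simp: abs_minus_commute)
      then show ?thesis using that by (simp add: field_simps)
    qed
    then have "\<forall>\<^sub>F y in at x within {0..R}. norm ((\<Phi> y - \<Phi> x) / (y - x)) \<le> K * \<bar>N y - N x\<bar>"
      by (auto simp: eventually_at_filter)
    from Lim_null_comparison[OF this lim] show ?thesis
      by (simp add: has_field_derivative_iff)
  qed
  then obtain c where "\<forall>x\<in>{0..R}. \<Phi> x = c"
    using has_field_derivative_zero_constant[of "{0..R}" \<Phi>] by auto
  then show ?thesis using R by auto
qed

text \<open>\<open>has_integral\<close> is the gauge integral, so absolute integrability is a
  separate demand; it makes \<open>\<bar>V\<bar>\<close> and the products of \<open>V\<close> with
  continuous functions integrable. \<open>W\<close> is free up to an additive constant, which is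
  fixed later.\<close>

definition locally_integrable_primitive :: "(real \<Rightarrow> real) \<Rightarrow> (real \<Rightarrow> real) \<Rightarrow> bool" where
  "locally_integrable_primitive V W \<longleftrightarrow>
     (\<forall>x\<ge>0. V absolutely_integrable_on {0..x} \<and> (V has_integral (W x - W 0)) {0..x})"

lemma locally_integrable_primitive_continuous:
  assumes "locally_integrable_primitive V W"
  shows "continuous_on {0..} W"
proof -
  have "continuous (at x within {0..}) W" if x: "0 \<le> x" for x
  proof -
    have "V integrable_on {0..x+1}"
      using assms x by (auto simp: locally_integrable_primitive_def dest!: spec[of _ "x+1"])
    then have "continuous_on {0..x+1} (\<lambda>t. W 0 + integral {0..t} V)"
      by (intro continuous_intros indefinite_integral_continuous_1)
    then have "continuous_on {0..x+1} W"
      by (rule continuous_on_eq)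
        (use assms in \<open>auto simp: locally_integrable_primitive_def dest!: integral_unique\<close>)
    then have "continuous (at x within {0..x+1}) W"
      using x by (simp add: continuous_on_eq_continuous_within)
    moreover have "at x within {0..x+1} = at x within {0..}"
      using x by (intro at_within_nhd[where S="{..<x+1}"]) auto
    ultimately show ?thesis by simp
  qed
  then show ?thesis by (simp add: continuous_on_eq_continuous_within)
qed

lemma absolutely_integrable_mult_continuous:
  fixes f V :: "real \<Rightarrow> real"
  assumes "continuous_on {a..b} f" "V absolutely_integrable_on {a..b}"
  shows "(\<lambda>x. f x * V x) absolutely_integrable_on {a..b}"
  using assms
  by (intro absolutely_integrable_bounded_measurable_product_real continuous_imp_measurable_on_sets_lebesgue
      compact_imp_bounded compact_continuous_image) auto

text \<open>
  Both sides have increments over \<open>[s, t]\<close> that differ by at most a constant times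
  \<open>(t - s) \<integral>\<^sub>s\<^sup>t |V|\<close>, so their difference has derivative zero everywhere although \<open>W\<close> is only absolutely
  continuous.
\<close>

lemma product_rule_primitive:
  assumes W: "locally_integrable_primitive V W"
    and y: "\<And>x. 0 \<le> x \<Longrightarrow> (y has_real_derivative y' x) (at x within {0..})"
    and y': "continuous_on {0..} y'" and R: "0 \<le> R"
  shows "((\<lambda>t. V t * y t + W t * y' t) has_integral (W R * y R - W 0 * y 0)) {0..R}"
proof -
  define h where "h t = y t * V t + W t * y' t" for t
  have y_cont: "continuous_on {0..} y"
    using y by (auto simp: continuous_on_eq_continuous_within dest: DERIV_continuous)
  have W_cont: "continuous_on {0..} W" by (rule locally_integrable_primitive_continuous[OF W])
  have V_abs: "V absolutely_integrable_on {s..t}" if "0 \<le> s" "s \<le> t" for s t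
    using W that by (auto simp: locally_integrable_primitive_def
        intro: absolutely_integrable_on_subinterval[where S="{0..t}"])
  have V_int: "V integrable_on {s..t}" if "0 \<le> s" "s \<le> t" for s t
    using V_abs[OF that] by (simp add: absolutely_integrable_on_def)
  have V_eq: "integral {s..t} V = W t - W s" if "0 \<le> s" "s \<le> t" for s t
  proof -
    have "integral {0..s} V + integral {s..t} V = integral {0..t} V"
      using that V_int[of 0 t] by (intro Henstock_Kurzweil_Integration.integral_combine) auto
    moreover have "integral {0..x} V = W x - W 0" if "0 \<le> x" for x
      using W that by (simp add: locally_integrable_primitive_def integral_unique)
    ultimately show ?thesis using that by simp
  qed
  have mult_abs: "(\<lambda>t. f t * V t) absolutely_integrable_on {s..t}"
    if "continuous_on {0..} f" "0 \<le> s" "s \<le> t" for f s t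
    using that V_abs
    by (intro absolutely_integrable_mult_continuous) (auto intro: continuous_on_subset[of "{0..}"])
  have mult_int: "(\<lambda>t. f t * V t) integrable_on {s..t}"
    if "continuous_on {0..} f" "0 \<le> s" "s \<le> t" for f s t
    using mult_abs[OF that] by (simp add: absolutely_integrable_on_def)
  have Wy'_int: "(\<lambda>t. W t * y' t) integrable_on {s..t}" if "0 \<le> s" "s \<le> t" for s t
    using that by (intro integrable_continuous_real continuous_intros continuous_on_subset[OF y']
        continuous_on_subset[OF W_cont]) auto
  have h_int: "h integrable_on {s..t}" if "0 \<le> s" "s \<le> t" for s t
    unfolding h_def using that y_cont by (intro integrable_add mult_int Wy'_int) auto
  define N where "N t = integral {0..t} (\<lambda>r. \<bar>V r\<bar>)" for t
  have absV_int: "(\<lambda>r. \<bar>V r\<bar>) integrable_on {s..t}" if "0 \<le> s" "s \<le> t" for s t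
    using V_abs[OF that] by (simp add: absolutely_integrable_on_def)
  have N_eq: "integral {s..t} (\<lambda>r. \<bar>V r\<bar>) = N t - N s" if "0 \<le> s" "s \<le> t" for s t
  proof -
    have "integral {0..s} (\<lambda>r. \<bar>V r\<bar>) + integral {s..t} (\<lambda>r. \<bar>V r\<bar>) = integral {0..t} (\<lambda>r. \<bar>V r\<bar>)"
      using that absV_int[of 0 t] by (intro Henstock_Kurzweil_Integration.integral_combine) auto
    then show ?thesis by (simp add: N_def)
  qed
  have N_mono: "N s \<le> N t" if "0 \<le> s" "s \<le> t" for s t
    using N_eq[OF that] integral_nonneg[OF absV_int[OF that]] by simp
  have W_le: "\<bar>W t - W s\<bar> \<le> N t - N s" if "0 \<le> s" "s \<le> t" for s t
    using integral_norm_bound_integral[OF V_int[OF that] absV_int[OF that]] V_eq[OF that] N_eq[OF that] by simp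
  obtain C where C: "\<And>r. r \<in> {0..R} \<Longrightarrow> \<bar>y' r\<bar> \<le> C" "0 \<le> C"
  proof -
    have "bounded (y' ` {0..R})"
      by (intro compact_imp_bounded compact_continuous_image continuous_on_subset[OF y']) auto
    then obtain C where "\<forall>v\<in>y' ` {0..R}. norm v \<le> C" by (auto simp: bounded_iff)
    then have "\<And>r. r \<in> {0..R} \<Longrightarrow> \<bar>y' r\<bar> \<le> \<bar>C\<bar>" by force
    then show ?thesis using that[of "\<bar>C\<bar>"] abs_ge_zero by blast
  qed
  have y_lip: "\<bar>y t - y s\<bar> \<le> C * (t - s)" if "0 \<le> s" "s \<le> t" "t \<le> R" for s t
  proof -
    have "norm (y t - y s) \<le> C * norm (t - s)"
    proof (rule field_differentiable_bound[of "{s..t}" y y'])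
      show "(y has_field_derivative y' r) (at r within {s..t})" if "r \<in> {s..t}" for r
        using y[of r] that \<open>0 \<le> s\<close> by (auto intro: DERIV_subset)
      show "norm (y' r) \<le> C" if "r \<in> {s..t}" for r
        using C(1)[of r] that \<open>0 \<le> s\<close> \<open>t \<le> R\<close> by auto
    qed (use that in auto)
    then show ?thesis using that by simp
  qed
  define \<Phi> where "\<Phi> x = W x * y x - integral {0..x} h" for x
  have "\<bar>\<Phi> t - \<Phi> s\<bar> \<le> (2 * C) * ((t - s) * \<bar>N t - N s\<bar>)" if st: "0 \<le> s" "s \<le> t" "t \<le> R" for s t
  proof -
    have y'_int: "(\<lambda>r. W t * y' r) integrable_on {s..t}"
      using st by (intro integrable_continuous_real continuous_intros continuous_on_subset[OF y']) auto
    have "((\<lambda>r. y' r) has_integral (y t - y s)) {s..t}"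
      using st by (intro fundamental_theorem_of_calculus)
        (auto simp flip: has_real_derivative_iff_has_vector_derivative intro!: DERIV_subset[OF y])
    then have Wt: "integral {s..t} (\<lambda>r. W t * y' r) = W t * (y t - y s)"
      by (simp add: integral_unique)
    have ys: "integral {s..t} (\<lambda>r. y s * V r) = y s * (W t - W s)"
      using V_eq st by simp
    have ysV_int: "(\<lambda>r. y s * V r) integrable_on {s..t}"
      using integrable_on_cmult_left[OF V_int[of s t], of "y s"] st by simp
    have hs: "integral {0..t} h - integral {0..s} h = integral {s..t} h"
      using Henstock_Kurzweil_Integration.integral_combine[of 0 s t h] h_int[of 0 t] st by simp
    \<comment> \<open>The increment of \<open>W * y\<close> is split as
      \<open>y s * (W t - W s) + W t * (y t - y s)\<close>. Compared with \<open>h\<close>, two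
      products remain, each with a small increment as a factor; each contributes at most
      \<open>C * (t - s) * (N t - N s)\<close>, whence the constant \<open>2 * C\<close>.\<close>
    have "\<Phi> t - \<Phi> s = integral {s..t} (\<lambda>r. y s * V r) + integral {s..t} (\<lambda>r. W t * y' r) - integral {s..t} h"
      unfolding Wt ys using hs by (simp add: \<Phi>_def algebra_simps)
    also have "\<dots> = integral {s..t} (\<lambda>r. (y s * V r + W t * y' r) - h r)"
      using h_int[of s t] ysV_int y'_int st
      by (simp only: integral_add[symmetric] integral_diff[symmetric] integrable_add)
    finally have "\<Phi> t - \<Phi> s = integral {s..t} (\<lambda>r. (y s * V r + W t * y' r) - h r)" .
    moreover have "norm (integral {s..t} (\<lambda>r. (y s * V r + W t * y' r) - h r))
       \<le> integral {s..t} (\<lambda>r. C * (t - s) * \<bar>V r\<bar> + (N t - N s) * C)"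
    proof (rule integral_norm_bound_integral)
      show "(\<lambda>r. (y s * V r + W t * y' r) - h r) integrable_on {s..t}"
        using h_int[of s t] ysV_int y'_int st
        by (intro integrable_diff integrable_add) auto
      show "(\<lambda>r. C * (t - s) * \<bar>V r\<bar> + (N t - N s) * C) integrable_on {s..t}"
        using integrable_on_cmult_left[OF absV_int[of s t], of "C * (t - s)"] st
        by (intro integrable_add) auto
      fix r assume r: "r \<in> {s..t}"
      have "(y s * V r + W t * y' r) - h r = (y s - y r) * V r + (W t - W r) * y' r"
        by (simp add: h_def algebra_simps)
      then have "norm ((y s * V r + W t * y' r) - h r) \<le> \<bar>y s - y r\<bar> * \<bar>V r\<bar> + \<bar>W t - W r\<bar> * \<bar>y' r\<bar>"
        by (metis abs_mult abs_triangle_ineq real_norm_def)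
      also have "\<dots> \<le> C * (t - s) * \<bar>V r\<bar> + (N t - N s) * C"
      proof (intro add_mono mult_mono)
        have "\<bar>y r - y s\<bar> \<le> C * (r - s)" using y_lip[of s r] r st by auto
        also have "\<dots> \<le> C * (t - s)" using C(2) r by (intro mult_left_mono) auto
        finally show "\<bar>y s - y r\<bar> \<le> C * (t - s)" by simp
        show "\<bar>W t - W r\<bar> \<le> N t - N s" using W_le[of r t] N_mono[of s r] r st by auto
        show "\<bar>y' r\<bar> \<le> C" using C(1) r st by auto
      qed (use C(2) st N_mono in auto)
      finally show "norm ((y s * V r + W t * y' r) - h r) \<le> C * (t - s) * \<bar>V r\<bar> + (N t - N s) * C" .
    qed
    moreover have "integral {s..t} (\<lambda>r. C * (t - s) * \<bar>V r\<bar> + (N t - N s) * C) = 2 * C * ((t - s) * (N t - N s))"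
    proof -
      have "integral {s..t} (\<lambda>r. C * (t - s) * \<bar>V r\<bar>) = C * (t - s) * (N t - N s)"
        using N_eq[of s t] st by (simp only: integral_mult_right)
      moreover have "integral {s..t} (\<lambda>r. (N t - N s) * C) = (t - s) * ((N t - N s) * C)"
        using st by simp
      moreover have "integral {s..t} (\<lambda>r. C * (t - s) * \<bar>V r\<bar> + (N t - N s) * C)
          = integral {s..t} (\<lambda>r. C * (t - s) * \<bar>V r\<bar>) + integral {s..t} (\<lambda>r. (N t - N s) * C)"
        using integrable_on_cmult_left[OF absV_int[of s t], of "C * (t - s)"] st
        by (intro integral_add) auto
      ultimately show ?thesis by (simp add: algebra_simps)
    qed
    ultimately show ?thesis using N_mono[of s t] st by simp
  qed
  moreover have "continuous_on {0..R} N"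
    unfolding N_def using absV_int R by (intro indefinite_integral_continuous_1) auto
  ultimately have "\<Phi> R = \<Phi> 0"
    using C(2) R by (intro constant_if_small_increments[of R N \<Phi> "2 * C"]) auto
  then have "integral {0..R} h = W R * y R - W 0 * y 0" by (simp add: \<Phi>_def)
  then have "(h has_integral (W R * y R - W 0 * y 0)) {0..R}"
    using h_int[of 0 R] R by (simp add: has_integral_iff)
  then show ?thesis by (simp add: h_def[abs_def] mult.commute)
qed

section \<open>Solutions in terms of quasi-derivatives\<close>

text \<open>\<open>W\<close> is normalised at \<open>b\<close>, so that quasi-derivatives are derivatives beyond \<open>b\<close>.\<close>

definition cutoff_primitive :: "(real \<Rightarrow> real) \<Rightarrow> real \<Rightarrow> (real \<Rightarrow> real) \<Rightarrow> bool" where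
  "cutoff_primitive V b W \<longleftrightarrow>
     0 \<le> b \<and> vanishes_beyond V b \<and> locally_integrable_primitive V W \<and> (\<forall>x\<ge>b. W x = 0)"

text \<open>
  With \<open>W' = V\<close> and the quasi-derivative \<open>z = y' - W y\<close>, the equation \<open>y'' = (V + \<mu>) y\<close> becomes a system
  with continuous coefficients, to which classical calculus applies.
\<close>

definition quasi_solution :: "(real \<Rightarrow> real) \<Rightarrow> real \<Rightarrow> (real \<Rightarrow> real) \<Rightarrow> (real \<Rightarrow> real) \<Rightarrow> bool" where
  "quasi_solution W \<mu> y z \<longleftrightarrow> (\<forall>x\<ge>0.
     (y has_real_derivative W x * y x + z x) (at x within {0..}) \<and>
     (z has_real_derivative \<mu> * y x - W x * (W x * y x + z x)) (at x within {0..}))"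

lemma quasi_solutionD:
  assumes "quasi_solution W \<mu> y z" "0 \<le> x"
  shows "(y has_real_derivative W x * y x + z x) (at x within {0..})"
    and "(z has_real_derivative \<mu> * y x - W x * (W x * y x + z x)) (at x within {0..})"
  using assms by (auto simp: quasi_solution_def)

lemma continuous_on_half_line_if_derivative:
  assumes "\<And>x. 0 \<le> x \<Longrightarrow> (y has_real_derivative y' x) (at x within {0..})"
  shows "continuous_on {0..} y"
  using assms by (auto simp: continuous_on_eq_continuous_within dest: DERIV_continuous)

lemma quasi_solution_continuous:
  assumes "quasi_solution W \<mu> y z"
  shows "continuous_on {0..} y" "continuous_on {0..} z"
  by (rule continuous_on_half_line_if_derivative, erule quasi_solutionD[OF assms])+

section \<open>Construction of \<open>W\<close> and solvability of the first-order system\<close>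

lemma AE_lebesgue_iff_negligible: "(AE x in lebesgue. P x) \<longleftrightarrow> negligible {x. \<not> P x}"
  for P :: "real \<Rightarrow> bool"
proof
  assume "AE x in lebesgue. P x"
  then obtain N where "negligible N" "{x. \<not> P x} \<subseteq> N"
    by (auto simp: eventually_ae_filter negligible_iff_null_sets)
  then show "negligible {x. \<not> P x}" by (rule negligible_subset)
next
  assume "negligible {x. \<not> P x}"
  then show "AE x in lebesgue. P x"
    unfolding eventually_ae_filter negligible_iff_null_sets by (intro bexI[of _ "{x. \<not> P x}"]) auto
qed

lemma cutoff_primitive_exists:
  assumes V: "V \<in> class_A" and b: "0 \<le> b" "vanishes_beyond V b"
  shows "\<exists>W. cutoff_primitive V b W"
proof -
  have "V absolutely_integrable_on {0..}"
  proof -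
    have "V absolutely_integrable_on {0<..} \<longleftrightarrow> V absolutely_integrable_on {0..}"
      by (rule absolutely_integrable_spike_set_eq; rule negligible_subset[of "{0}"]) auto
    then show ?thesis using V by (simp add: class_A_def)
  qed
  then have V_abs: "V absolutely_integrable_on {0..x}" for x
    by (rule absolutely_integrable_on_subinterval) auto
  then have V_int: "V integrable_on {0..x}" for x
    by (simp add: absolutely_integrable_on_def)
  define W where "W x = integral {0..x} V - integral {0..b} V" for x
  have "W x = 0" if x: "b \<le> x" for x
  proof -
    have "(V has_integral 0) {b..x}"
    proof (rule has_integral_spike)
      have "negligible {x. \<not> (b < x \<longrightarrow> V x = 0)}"
        using b(2) by (simp only: vanishes_beyond_def AE_lebesgue_iff_negligible)
      \<comment> \<open>\<open>V b\<close> itself may be nonzero, so the endpoint joins the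
        exceptional set.\<close>
      then show "negligible (insert b {x. \<not> (b < x \<longrightarrow> V x = 0)})"
        by (simp only: negligible_insert)
      show "((\<lambda>x. 0) has_integral (0::real)) {b..x}" by simp
    qed auto
    moreover have "integral {0..b} V + integral {b..x} V = integral {0..x} V"
      using x b V_int by (intro Henstock_Kurzweil_Integration.integral_combine) auto
    ultimately show ?thesis by (simp add: W_def integral_unique)
  qed
  moreover have "locally_integrable_primitive V W"
    unfolding locally_integrable_primitive_def W_def using V_abs V_int by (simp add: integrable_integral)
  ultimately show ?thesis using b by (auto simp: cutoff_primitive_def)
qed

lemma cutoff_primitive_continuous: "cutoff_primitive V b W \<Longrightarrow> continuous_on {0..} W"
  unfolding cutoff_primitive_def using locally_integrable_primitive_continuous by blast

lemma cutoff_primitive_bounded: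
  assumes "cutoff_primitive V b W"
  obtains K where "0 \<le> K" "\<And>x. 0 \<le> x \<Longrightarrow> \<bar>W x\<bar> \<le> K"
proof -
  have "bounded (W ` {0..b})"
    by (intro compact_imp_bounded compact_continuous_image
        continuous_on_subset[OF cutoff_primitive_continuous[OF assms]]) auto
  then obtain K where K: "\<forall>v\<in>W ` {0..b}. norm v \<le> K" by (auto simp: bounded_iff)
  have W_le: "\<bar>W x\<bar> \<le> \<bar>K\<bar>" if "x \<in> {0..b}" for x
  proof -
    have "norm (W x) \<le> K" using K imageI[OF that] by (rule bspec)
    then show ?thesis by simp
  qed
  have "\<bar>W x\<bar> \<le> \<bar>K\<bar>" if "0 \<le> x" for x
  proof (cases "x \<le> b")
    case True
    then show ?thesis using W_le that by simp
  next
    case False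
    then have "W x = 0" using assms by (simp add: cutoff_primitive_def)
    then show ?thesis by simp
  qed
  then show thesis by (rule that[OF abs_ge_zero])
qed

text \<open>\<open>W\<close> is bounded on the whole half-line, so this linear system has one
  Lipschitz constant for all \<open>t\<close>.\<close>

lemma quasi_solution_exists:
  assumes W: "cutoff_primitive V b W"
  shows "\<exists>y z. quasi_solution W \<mu> y z \<and> y 0 = p \<and> z 0 = q"
proof -
  obtain K where K: "0 \<le> K" "\<And>x. 0 \<le> x \<Longrightarrow> \<bar>W x\<bar> \<le> K" using cutoff_primitive_bounded[OF W] by metis
  define F :: "real \<Rightarrow> real \<times> real \<Rightarrow> real \<times> real" where
    "F t u = (W t * fst u + snd u, \<mu> * fst u - W t * (W t * fst u + snd u))" for t u
  \<comment> \<open>The first summand bounds the first component of \<open>F t u\<close> relative to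
    \<open>norm u\<close>, the second one the second component.\<close>
  define C where "C = (K + 1) + (\<bar>\<mu>\<bar> + K * (K + 1))"
  have "norm (F t u) \<le> C * norm u" if t: "0 \<le> t" for t u
  proof -
    have fst_le: "\<bar>fst u\<bar> \<le> norm u" and snd_le: "\<bar>snd u\<bar> \<le> norm u"
      using norm_fst_le[of "fst u" "snd u"] norm_snd_le[of "snd u" "fst u"] by auto
    have "\<bar>W t * fst u + snd u\<bar> \<le> \<bar>W t\<bar> * \<bar>fst u\<bar> + \<bar>snd u\<bar>"
      by (metis abs_mult abs_triangle_ineq)
    also have "\<dots> \<le> K * norm u + norm u"
      using K t fst_le snd_le by (intro add_mono mult_mono) auto
    finally have first: "\<bar>W t * fst u + snd u\<bar> \<le> (K + 1) * norm u" by (simp add: algebra_simps)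
    have "\<bar>\<mu> * fst u - W t * (W t * fst u + snd u)\<bar> \<le> \<bar>\<mu>\<bar> * \<bar>fst u\<bar> + \<bar>W t\<bar> * \<bar>W t * fst u + snd u\<bar>"
      by (metis abs_mult abs_triangle_ineq4)
    also have "\<dots> \<le> \<bar>\<mu>\<bar> * norm u + K * ((K + 1) * norm u)"
      using K t fst_le first by (intro add_mono mult_mono) auto
    finally have "\<bar>\<mu> * fst u - W t * (W t * fst u + snd u)\<bar> \<le> (\<bar>\<mu>\<bar> + K * (K + 1)) * norm u"
      by (simp add: algebra_simps)
    with first have "\<bar>fst (F t u)\<bar> + \<bar>snd (F t u)\<bar> \<le> C * norm u"
      by (simp add: F_def C_def algebra_simps)
    then show ?thesis
      using norm_Pair_le[of "fst (F t u)" "snd (F t u)"] by simp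
  qed
  moreover have "F t u - F t v = F t (u - v)" for t u v by (simp add: F_def algebra_simps)
  ultimately have lip: "norm (F t u - F t v) \<le> C * norm (u - v)" if "0 \<le> t" for t u v
    using that by simp
  have "\<exists>X. X 0 = (p, q) \<and> (\<forall>t\<ge>0. (X has_vector_derivative F t (X t)) (at t within {0..}))"
  proof (rule lipschitz_ode_exists[where K=C])
    fix X :: "real \<Rightarrow> real \<times> real" assume X: "continuous_on {0..} X"
    show "continuous_on {0..} (\<lambda>t. F t (X t))"
      unfolding F_def by (intro continuous_intros X cutoff_primitive_continuous[OF W])
  next
    show "0 \<le> C" using K(1) by (simp add: C_def)
    show "F t 0 = 0" for t by (simp add: F_def prod_eq_iff)
  qed (rule lip)
  then obtain X where X: "X 0 = (p, q)"
    "\<And>t. 0 \<le> t \<Longrightarrow> (X has_vector_derivative F t (X t)) (at t within {0..})" by blast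
  have "quasi_solution W \<mu> (\<lambda>t. fst (X t)) (\<lambda>t. snd (X t))"
    unfolding quasi_solution_def
  proof (intro allI impI conjI)
    fix t :: real assume "0 \<le> t"
    note D = X(2)[OF this]
    show "((\<lambda>t. fst (X t)) has_real_derivative W t * fst (X t) + snd (X t)) (at t within {0..})"
      using bounded_linear.has_vector_derivative[OF bounded_linear_fst D]
      by (simp add: has_real_derivative_iff_has_vector_derivative F_def)
    show "((\<lambda>t. snd (X t)) has_real_derivative
        \<mu> * fst (X t) - W t * (W t * fst (X t) + snd (X t))) (at t within {0..})"
      using bounded_linear.has_vector_derivative[OF bounded_linear_snd D]
      by (simp add: has_real_derivative_iff_has_vector_derivative F_def)
  qed
  moreover have "fst (X 0) = p" "snd (X 0) = q" using X(1) by simp_all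
  ultimately show ?thesis by blast
qed

section \<open>Passage between the first-order system and the Schroedinger equation\<close>

lemma deriv0_eqI: "0 \<le> x \<Longrightarrow> (\<psi> has_vector_derivative D) (at x within {0..}) \<Longrightarrow> deriv0 \<psi> x = D"
  by (rule vector_derivative_within[OF at_within_half_line_neq_bot])

lemma i_times_of_real_squared: "(\<i> * complex_of_real \<beta>)\<^sup>2 = - complex_of_real (\<beta>\<^sup>2)"
  by (simp add: power_mult_distrib)

text \<open>The product rule for \<open>W y\<close> and the fundamental theorem for \<open>z\<close>
  are added; the terms \<open>W y'\<close> cancel and the integral of
  \<open>(V + \<beta>\<^sup>2) y\<close> remains. This is how the choices in
  \<open>jost_solution\<close> and \<open>regular_solution\<close> are seen to have
  candidates.\<close>

lemma schroedinger_solution_of_quasi_solution: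
  assumes W: "locally_integrable_primitive V W" and yz: "quasi_solution W (\<beta>\<^sup>2) y z"
  shows "schroedinger_solution V (\<i> * complex_of_real \<beta>) (\<lambda>x. complex_of_real (y x))"
    and "\<And>x. 0 \<le> x \<Longrightarrow> deriv0 (\<lambda>x. complex_of_real (y x)) x = of_real (W x * y x + z x)"
proof -
  note y = quasi_solutionD(1)[OF yz] and z = quasi_solutionD(2)[OF yz]
  have vd: "((\<lambda>x. complex_of_real (y x)) has_vector_derivative of_real (W x * y x + z x)) (at x within {0..})"
    if "0 \<le> x" for x
    using has_vector_derivative_of_real[OF y[OF that]] .
  show d: "deriv0 (\<lambda>x. complex_of_real (y x)) x = of_real (W x * y x + z x)" if "0 \<le> x" for x
    by (rule deriv0_eqI[OF that vd[OF that]])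
  have cont: "continuous_on {0..} (\<lambda>x. W x * y x + z x)"
    by (intro continuous_intros locally_integrable_primitive_continuous[OF W] quasi_solution_continuous[OF yz])
  have int: "((\<lambda>t. (V t + \<beta>\<^sup>2) * y t) has_integral (W x * y x + z x) - (W 0 * y 0 + z 0)) {0..x}"
    if x: "0 \<le> x" for x
  proof -
    have 1: "((\<lambda>t. V t * y t + W t * (W t * y t + z t)) has_integral (W x * y x - W 0 * y 0)) {0..x}"
      by (rule product_rule_primitive[OF W y cont x])
    have 2: "((\<lambda>t. \<beta>\<^sup>2 * y t - W t * (W t * y t + z t)) has_integral (z x - z 0)) {0..x}"
      using x by (intro fundamental_theorem_of_calculus)
        (auto simp flip: has_real_derivative_iff_has_vector_derivative intro!: DERIV_subset[OF z])
    show ?thesis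
      using has_integral_add[OF 1 2] by (simp add: algebra_simps)
  qed
  show "schroedinger_solution V (\<i> * complex_of_real \<beta>) (\<lambda>x. complex_of_real (y x))"
    unfolding schroedinger_solution_def
  proof (intro conjI allI impI)
    fix x :: real assume x: "0 \<le> x"
    show "(\<lambda>x. complex_of_real (y x)) differentiable at x within {0..}"
      using vd[OF x] by (rule differentiableI_vector)
    have "((\<lambda>t. (of_real (V t) - (\<i> * complex_of_real \<beta>)\<^sup>2) * complex_of_real (y t))
        has_integral of_real ((W x * y x + z x) - (W 0 * y 0 + z 0))) {0..x}"
      using has_integral_of_real[OF int[OF x]] unfolding i_times_of_real_squared by simp
    then show "deriv0 (\<lambda>x. complex_of_real (y x)) x = deriv0 (\<lambda>x. complex_of_real (y x)) 0 +
       integral {0..x} (\<lambda>t. (of_real (V t) - (\<i> * complex_of_real \<beta>)\<^sup>2) * complex_of_real (y t))"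
      using d[OF x] d[of 0] by (simp add: integral_unique)
  qed
qed

text \<open>\<open>r\<close> will be the real or the imaginary part.\<close>

lemma quasi_solution_of_schroedinger_solution:
  fixes r :: "complex \<Rightarrow> real"
  assumes r: "bounded_linear r"
    and W: "locally_integrable_primitive V W"
    and \<psi>: "schroedinger_solution V (\<i> * complex_of_real \<beta>) \<psi>"
  shows "quasi_solution W (\<beta>\<^sup>2) (\<lambda>x. r (\<psi> x)) (\<lambda>x. r (deriv0 \<psi> x) - W x * r (\<psi> x))"
proof -
  define y where "y x = r (\<psi> x)" for x
  define y' where "y' x = r (deriv0 \<psi> x)" for x
  define z where "z x = y' x - W x * y x" for x
  have \<psi>_der: "(\<psi> has_vector_derivative deriv0 \<psi> x) (at x within {0..})" if "0 \<le> x" for x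
    using \<psi> that unfolding schroedinger_solution_def by (blast intro: vector_derivative_works[THEN iffD1])
  then have \<psi>_cont: "continuous_on {0..} \<psi>"
    by (metis atLeast_iff continuous_on_eq_continuous_within has_vector_derivative_continuous)
  have y_der: "(y has_real_derivative y' x) (at x within {0..})" if "0 \<le> x" for x
    using bounded_linear.has_vector_derivative[OF r \<psi>_der[OF that]]
    by (simp add: has_real_derivative_iff_has_vector_derivative y_def[abs_def] y'_def)
  define h where "h t = (V t + \<beta>\<^sup>2) *\<^sub>R \<psi> t" for t
  have h_eq: "(\<lambda>t. (of_real (V t) - (\<i> * complex_of_real \<beta>)\<^sup>2) * \<psi> t) = h"
    unfolding i_times_of_real_squared h_def[abs_def] by (simp add: scaleR_conv_of_real)
  \<comment> \<open>\<open>integral\<close> defaults to \<open>0\<close> on functions that are not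
    integrable, so the equation in \<open>schroedinger_solution\<close> yields a
    \<open>has_integral\<close> statement only together with integrability.\<close>
  have h_int: "h integrable_on {0..x}" if "0 \<le> x" for x
  proof -
    have "(\<lambda>t. V t + \<beta>\<^sup>2) absolutely_integrable_on {0..x}"
      using W that by (intro set_integral_add)
        (auto simp: locally_integrable_primitive_def intro!: absolutely_integrable_continuous_real)
    moreover have "bilinear (\<lambda>(u::complex) (c::real). c *\<^sub>R u)"
      by (auto simp: bilinear_def linear_iff algebra_simps)
    ultimately have "(\<lambda>t. (V t + \<beta>\<^sup>2) *\<^sub>R \<psi> t) absolutely_integrable_on {0..x}"
      using \<psi>_cont
      by (intro absolutely_integrable_bounded_measurable_product[where h="\<lambda>u c. c *\<^sub>R u"]
          continuous_imp_measurable_on_sets_lebesgue compact_imp_bounded compact_continuous_image)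
        (auto intro: continuous_on_subset[of "{0..}" \<psi>])
    then show ?thesis by (simp add: absolutely_integrable_on_def h_def[abs_def])
  qed
  have y'_int: "((\<lambda>t. (V t + \<beta>\<^sup>2) * y t) has_integral (y' x - y' 0)) {0..x}" if "0 \<le> x" for x
  proof -
    have "deriv0 \<psi> x = deriv0 \<psi> 0 + integral {0..x} h"
      using \<psi> that unfolding schroedinger_solution_def h_eq by blast
    then have "integral {0..x} h = deriv0 \<psi> x - deriv0 \<psi> 0" by (simp only: add_diff_cancel_left')
    then have "(h has_integral (deriv0 \<psi> x - deriv0 \<psi> 0)) {0..x}"
      using integrable_integral[OF h_int[OF that]] by (simp only:)
    from has_integral_linear[OF this r] show ?thesis
      by (simp add: o_def h_def y_def y'_def linear_simps[OF r])
  qed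
  have y_cont: "continuous_on {0..} y" by (rule continuous_on_half_line_if_derivative[OF y_der])
  have y'_cont: "continuous_on {0..} y'"
  proof (rule locally_integrable_primitive_continuous[of "\<lambda>t. (V t + \<beta>\<^sup>2) * y t"])
    have "(\<lambda>t. y t * (V t + \<beta>\<^sup>2)) absolutely_integrable_on {0..x}" if "0 \<le> x" for x
      using W that
      by (intro absolutely_integrable_mult_continuous continuous_on_subset[OF y_cont] set_integral_add)
        (auto simp: locally_integrable_primitive_def intro!: absolutely_integrable_continuous_real)
    then show "locally_integrable_primitive (\<lambda>t. (V t + \<beta>\<^sup>2) * y t) y'"
      using y'_int by (simp add: locally_integrable_primitive_def mult.commute)
  qed
  have W_cont: "continuous_on {0..} W" by (rule locally_integrable_primitive_continuous[OF W])
  \<comment> \<open>\<open>V\<close> drops out of the derivative of \<open>z = y' - W y\<close>; the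
    integrand left is continuous, so \<open>z\<close> is differentiable at every point.\<close>
  have z_int: "((\<lambda>t. \<beta>\<^sup>2 * y t - W t * y' t) has_integral (z x - z 0)) {0..x}" if "0 \<le> x" for x
    using has_integral_diff[OF y'_int[OF that] product_rule_primitive[OF W y_der y'_cont that]]
    by (simp add: z_def algebra_simps)
  have z_der: "(z has_real_derivative \<beta>\<^sup>2 * y x - W x * y' x) (at x within {0..})" if x: "0 \<le> x" for x
  proof -
    have I: "((\<lambda>x. integral {0..x} (\<lambda>t. \<beta>\<^sup>2 * y t - W t * y' t)) has_vector_derivative
        \<beta>\<^sup>2 * y x - W x * y' x) (at x within {0..})"
      by (intro integral_has_vector_derivative_half_line continuous_intros y_cont y'_cont W_cont x)
    have "((\<lambda>x. z x - z 0) has_vector_derivative \<beta>\<^sup>2 * y x - W x * y' x) (at x within {0..})"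
      by (rule has_vector_derivative_transform[OF _ _ I]) (use x in \<open>simp_all add: integral_unique[OF z_int]\<close>)
    then have "((\<lambda>x. z x - z 0) has_real_derivative \<beta>\<^sup>2 * y x - W x * y' x) (at x within {0..})"
      by (simp add: has_real_derivative_iff_has_vector_derivative)
    from DERIV_add[OF this DERIV_const[of "z 0"]] show ?thesis by simp
  qed
  have "quasi_solution W (\<beta>\<^sup>2) y z"
    using y_der z_der by (simp add: quasi_solution_def z_def)
  then show ?thesis by (simp add: y_def[abs_def] z_def[abs_def] y'_def[abs_def])
qed

section \<open>Wronskians and the Jost function\<close>

text \<open>Written with quasi-derivatives this is still the ordinary Wronskian, since the terms
  \<open>W y1 y2\<close> cancel.\<close>

lemma wronskian_derivative:
  assumes "quasi_solution W \<mu>1 y1 z1" "quasi_solution W \<mu>2 y2 z2" "0 \<le> x"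
  shows "((\<lambda>x. y1 x * z2 x - z1 x * y2 x) has_real_derivative (\<mu>2 - \<mu>1) * (y1 x * y2 x)) (at x within {0..})"
  by (rule derivative_eq_intros quasi_solutionD[OF assms(1,3)] quasi_solutionD[OF assms(2,3)] refl)+
    (simp add: algebra_simps)

lemma constant_on_ray:
  fixes f :: "real \<Rightarrow> real"
  assumes "\<And>x. a \<le> x \<Longrightarrow> (f has_real_derivative 0) (at x within {0..})" "0 \<le> a" "a \<le> x"
  shows "f x = f a"
proof -
  have "(f has_real_derivative 0) (at x within {a..})" if "x \<in> {a..}" for x
    using assms(1)[of x] by (rule DERIV_subset) (use assms(2) that in auto)
  then obtain c where "\<forall>x\<in>{a..}. f x = c"
    using has_field_derivative_zero_constant[of "{a..}" f] by auto
  then show ?thesis using assms(3) by auto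
qed

lemma wronskian_constant:
  assumes "quasi_solution W \<mu> y1 z1" "quasi_solution W \<mu> y2 z2" "0 \<le> x"
  shows "y1 x * z2 x - z1 x * y2 x = y1 0 * z2 0 - z1 0 * y2 0"
  using constant_on_ray[of 0 "\<lambda>x. y1 x * z2 x - z1 x * y2 x" x] wronskian_derivative[OF assms(1,2)] assms(3)
  by simp

text \<open>Beyond \<open>b\<close> the expression is the Wronskian with the solution
  \<open>exp (- (\<beta> * x))\<close>; it will turn out to be the value of \<open>H\<close> at
  \<beta>. The sign of \<beta> is arbitrary, and negative values are used later.\<close>

lemma decaying_component_constant:
  assumes W: "cutoff_primitive V b W" and yz: "quasi_solution W (\<beta>\<^sup>2) y z" and x: "b \<le> x"
  shows "exp (- (\<beta> * x)) * (z x + \<beta> * y x) = exp (- (\<beta> * b)) * (z b + \<beta> * y b)"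
proof (rule constant_on_ray[of b "\<lambda>x. exp (- (\<beta> * x)) * (z x + \<beta> * y x)" x])
  fix x assume x: "b \<le> x"
  then have x0: "0 \<le> x" and W0: "W x = 0" using W by (auto simp: cutoff_primitive_def)
  show "((\<lambda>x. exp (- (\<beta> * x)) * (z x + \<beta> * y x)) has_real_derivative 0) (at x within {0..})"
    by (rule derivative_eq_intros quasi_solutionD[OF yz x0] refl)+
      (simp add: algebra_simps W0 power2_eq_square)
qed (use W x in \<open>auto simp: cutoff_primitive_def\<close>)

lemma quasi_solution_linear_combination:
  assumes "quasi_solution W \<mu> y1 z1" "quasi_solution W \<mu> y2 z2"
  shows "quasi_solution W \<mu> (\<lambda>x. A * y1 x + B * y2 x) (\<lambda>x. A * z1 x + B * z2 x)"
  unfolding quasi_solution_def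
proof (intro allI impI conjI)
  fix x :: real assume x: "0 \<le> x"
  show "((\<lambda>x. A * y1 x + B * y2 x) has_real_derivative
      W x * (A * y1 x + B * y2 x) + (A * z1 x + B * z2 x)) (at x within {0..})"
    by (rule derivative_eq_intros quasi_solutionD[OF assms(1) x] quasi_solutionD[OF assms(2) x] refl)+
      (simp add: algebra_simps)
  show "((\<lambda>x. A * z1 x + B * z2 x) has_real_derivative \<mu> * (A * y1 x + B * y2 x) -
      W x * (W x * (A * y1 x + B * y2 x) + (A * z1 x + B * z2 x))) (at x within {0..})"
    by (rule derivative_eq_intros quasi_solutionD[OF assms(1) x] quasi_solutionD[OF assms(2) x] refl)+
      (simp add: algebra_simps)
qed

text \<open>The condition at \<open>b\<close> makes the Wronskian with
  \<open>exp (- (\<beta> * x))\<close> vanish, so \<open>y\<close> is a multiple of this exponential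
  beyond \<open>b\<close>. Taken at \<gamma> this describes a bound state, taken at -\<kappa> the
  growing solution.\<close>

lemma exponential_beyond_cutoff:
  assumes W: "cutoff_primitive V b W" and yz: "quasi_solution W (\<beta>\<^sup>2) y z"
    and zb: "z b = - \<beta> * y b" and x: "b \<le> x"
  shows "z x = - \<beta> * y x" "y x = y b * exp (- (\<beta> * (x - b)))"
proof -
  have z: "z x = - \<beta> * y x" if "b \<le> x" for x
    using decaying_component_constant[OF W yz that] zb by simp
  show "z x = - \<beta> * y x" by (rule z[OF x])
  have "exp (\<beta> * x) * y x = exp (\<beta> * b) * y b"
  proof (rule constant_on_ray[of b "\<lambda>x. exp (\<beta> * x) * y x" x])
    fix x assume x: "b \<le> x"
    then have x0: "0 \<le> x" and W0: "W x = 0" using W by (auto simp: cutoff_primitive_def)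
    show "((\<lambda>x. exp (\<beta> * x) * y x) has_real_derivative 0) (at x within {0..})"
      by (rule derivative_eq_intros quasi_solutionD[OF yz x0] refl)+
        (simp add: algebra_simps W0 z[OF x])
  qed (use W x in \<open>auto simp: cutoff_primitive_def\<close>)
  then have "exp (- (\<beta> * x)) * (exp (\<beta> * x) * y x) = exp (- (\<beta> * x)) * (exp (\<beta> * b) * y b)" by simp
  then have "y x = exp (- (\<beta> * x)) * exp (\<beta> * b) * y b"
    by (simp only: mult.assoc[symmetric] exp_minus_inverse mult.commute[of "exp (- (\<beta> * x))" "exp (\<beta> * x)"] mult_1)
  then show "y x = y b * exp (- (\<beta> * (x - b)))"
    by (simp add: algebra_simps flip: exp_add)
qed

text \<open>Solutions have been constructed from data at \<open>0\<close>, whereas the Jost solution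
  is prescribed at \<open>b\<close>. By constancy of the Wronskian the transfer matrix from
  \<open>0\<close> to \<open>b\<close> has determinant 1, so it can be inverted.\<close>

lemma jost_quasi_solution_exists:
  assumes W: "cutoff_primitive V b W"
  shows "\<exists>y z. quasi_solution W (\<beta>\<^sup>2) y z \<and> (\<forall>x\<ge>b. y x = exp (- (\<beta> * x)))"
proof -
  have b: "0 \<le> b" using W by (simp add: cutoff_primitive_def)
  obtain y1 z1 where 1: "quasi_solution W (\<beta>\<^sup>2) y1 z1" "y1 0 = 1" "z1 0 = 0"
    using quasi_solution_exists[OF W] by blast
  obtain y2 z2 where 2: "quasi_solution W (\<beta>\<^sup>2) y2 z2" "y2 0 = 0" "z2 0 = 1"
    using quasi_solution_exists[OF W] by blast
  have w: "y1 b * z2 b - z1 b * y2 b = 1"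
    using wronskian_constant[OF 1(1) 2(1) b] 1 2 by simp
  define e where "e = exp (- (\<beta> * b))"
  \<comment> \<open>Cramer's rule for \<open>y b = e\<close> and
    \<open>z b = - \<beta> * e\<close>.\<close>
  define A where "A = e * z2 b + \<beta> * e * y2 b"
  define B where "B = - (y1 b * \<beta> * e) - z1 b * e"
  define y where "y x = A * y1 x + B * y2 x" for x
  define z where "z x = A * z1 x + B * z2 x" for x
  have yz: "quasi_solution W (\<beta>\<^sup>2) y z"
    unfolding y_def z_def by (rule quasi_solution_linear_combination[OF 1(1) 2(1)])
  have "y b = e * (y1 b * z2 b - z1 b * y2 b)" "z b = - \<beta> * e * (y1 b * z2 b - z1 b * y2 b)"
    by (simp_all add: y_def z_def A_def B_def algebra_simps)
  then have yb: "y b = e" and "z b = - \<beta> * y b" using w by simp_all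
  then have "y x = e * exp (- (\<beta> * (x - b)))" if "b \<le> x" for x
    using exponential_beyond_cutoff[OF W yz _ that] by simp
  then have "y x = exp (- (\<beta> * x))" if "b \<le> x" for x
    using that by (simp add: e_def algebra_simps flip: exp_add)
  then show ?thesis using yz by blast
qed

section \<open>The regular solution and the Jost function on the imaginary axis\<close>

definition boundary_value :: "real \<Rightarrow> real" where
  "boundary_value \<theta> = (if \<theta> = pi then 0 else 1)"

definition boundary_slope :: "real \<Rightarrow> real" where
  "boundary_slope \<theta> = (if \<theta> = pi then 1 else - cot \<theta>)"

text \<open>\<beta> occurs only squared, so the same \<open>y\<close> and \<open>z\<close> serve for
  \<open>- \<beta>\<close>. The correction by \<open>W 0\<close> converts the initial derivative
  into a quasi-derivative.\<close>

definition regular_quasi_solution ::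
    "(real \<Rightarrow> real) \<Rightarrow> real \<Rightarrow> real \<Rightarrow> (real \<Rightarrow> real) \<Rightarrow> (real \<Rightarrow> real) \<Rightarrow> bool" where
  "regular_quasi_solution W \<theta> \<beta> y z \<longleftrightarrow> quasi_solution W (\<beta>\<^sup>2) y z \<and>
     y 0 = boundary_value \<theta> \<and> z 0 = boundary_slope \<theta> - W 0 * boundary_value \<theta>"

text \<open>The quasi-solution built in the proof only shows that the choice in
  \<open>regular_solution\<close> succeeds; the conclusion is then read off from the chosen
  function.\<close>

lemma phi_regular_quasi_solution:
  assumes W: "cutoff_primitive V b W"
  shows "\<exists>z. regular_quasi_solution W \<theta> \<beta> (phi V \<theta> \<beta>) z"
proof -
  have lip: "locally_integrable_primitive V W" using W by (simp add: cutoff_primitive_def)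
  define S where "S \<phi> \<longleftrightarrow> schroedinger_solution V (\<i> * complex_of_real \<beta>) \<phi> \<and>
     (if \<theta> = pi then \<phi> 0 = 0 \<and> deriv0 \<phi> 0 = 1
      else \<phi> 0 = 1 \<and> deriv0 \<phi> 0 = - of_real (cot \<theta>))" for \<phi>
  obtain y z where yz: "quasi_solution W (\<beta>\<^sup>2) y z" "y 0 = boundary_value \<theta>"
      "z 0 = boundary_slope \<theta> - W 0 * boundary_value \<theta>"
    using quasi_solution_exists[OF W] by blast
  have "S (\<lambda>x. complex_of_real (y x))"
    using schroedinger_solution_of_quasi_solution[OF lip yz(1)] yz
    by (auto simp: S_def boundary_value_def boundary_slope_def)
  then have "S (SOME \<phi>. S \<phi>)" by (rule someI[of S])
  moreover have "regular_solution V \<theta> (\<i> * complex_of_real \<beta>) = (SOME \<phi>. S \<phi>)"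
    by (simp only: regular_solution_def S_def)
  ultimately have R: "S (regular_solution V \<theta> (\<i> * complex_of_real \<beta>))" by simp
  define \<phi> where "\<phi> = regular_solution V \<theta> (\<i> * complex_of_real \<beta>)"
  have "quasi_solution W (\<beta>\<^sup>2) (\<lambda>x. Re (\<phi> x)) (\<lambda>x. Re (deriv0 \<phi> x) - W x * Re (\<phi> x))"
    using R by (intro quasi_solution_of_schroedinger_solution[OF bounded_linear_Re lip])
      (simp add: S_def \<phi>_def)
  then have "regular_quasi_solution W \<theta> \<beta> (phi V \<theta> \<beta>) (\<lambda>x. Re (deriv0 \<phi> x) - W x * Re (\<phi> x))"
    using R unfolding regular_quasi_solution_def phi_def[abs_def] S_def \<phi>_def[symmetric]
    by (auto simp: boundary_value_def boundary_slope_def)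
  then show ?thesis by blast
qed

text \<open>For both kinds of boundary condition \<open>jost_H\<close> is the Wronskian at
  \<open>0\<close> of the Jost and the regular solution, and a Wronskian can be moved to where the
  Jost solution is exponential.\<close>

lemma jost_H_eq:
  assumes W: "cutoff_primitive V b W" and yz: "regular_quasi_solution W \<theta> \<beta> y z"
  shows "jost_H V \<theta> \<beta> = of_real (exp (- (\<beta> * b)) * (z b + \<beta> * y b))"
proof -
  have lip: "locally_integrable_primitive V W" and b: "0 \<le> b" "vanishes_beyond V b"
    using W by (auto simp: cutoff_primitive_def)
  have y0: "y 0 = boundary_value \<theta>" and z0: "z 0 = boundary_slope \<theta> - W 0 * boundary_value \<theta>"
    using yz by (auto simp: regular_quasi_solution_def)
  define k where "k = \<i> * complex_of_real \<beta>"
  define S where "S f \<longleftrightarrow> schroedinger_solution V k f \<and>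
     (\<exists>b\<ge>0. vanishes_beyond V b \<and> (\<forall>x\<ge>b. f x = exp (\<i> * k * of_real x)))" for f
  have k_exp: "exp (\<i> * k * of_real x) = complex_of_real (exp (- (\<beta> * x)))" for x
    by (simp add: k_def exp_of_real flip: of_real_mult of_real_minus)
  obtain u v where uv: "quasi_solution W (\<beta>\<^sup>2) u v" "\<forall>x\<ge>b. u x = exp (- (\<beta> * x))"
    using jost_quasi_solution_exists[OF W] by blast
  have "S (\<lambda>x. complex_of_real (u x))"
    using schroedinger_solution_of_quasi_solution(1)[OF lip uv(1)] uv(2) b
    unfolding S_def k_exp unfolding k_def by auto
  then have "S (SOME f. S f)" by (rule someI[of S])
  moreover have "jost_solution V k = (SOME f. S f)" by (simp only: jost_solution_def S_def)
  ultimately have Sf: "S (jost_solution V k)" by simp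
  define f where "f = jost_solution V k"
  obtain b' where b': "0 \<le> b'" "\<And>x. b' \<le> x \<Longrightarrow> f x = complex_of_real (exp (- (\<beta> * x)))"
    using Sf unfolding S_def f_def[symmetric] k_exp by auto
  have sol: "schroedinger_solution V (\<i> * complex_of_real \<beta>) f" using Sf by (simp add: S_def f_def k_def)
  \<comment> \<open>The cutoff \<open>b'\<close> behind \<open>jost_solution\<close> may differ from
    \<open>b\<close>; beyond both, everything is explicit. The added 1 leaves room on the left of
    \<open>X\<close> for differentiating the exponential.\<close>
  define X where "X = max b b' + 1"
  have X: "b \<le> X" "b' < X" "0 \<le> X" "W X = 0" using b W by (auto simp: X_def cutoff_primitive_def)
  \<comment> \<open>Applied to \<open>Re\<close> with \<open>c = 1\<close> and to \<open>Im\<close>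
    with \<open>c = 0\<close>; the second case shows that \<open>jost_H\<close> is real.\<close>
  have *: "r (f 0) * boundary_slope \<theta> - r (deriv0 f 0) * boundary_value \<theta> =
      c * (exp (- (\<beta> * b)) * (z b + \<beta> * y b))"
    if r: "bounded_linear r" and c: "\<And>a. r (complex_of_real a) = c * a" for r and c :: real
  proof -
    define s where "s x = r (deriv0 f x) - W x * r (f x)" for x
    have rs: "quasi_solution W (\<beta>\<^sup>2) (\<lambda>x. r (f x)) s"
      unfolding s_def by (rule quasi_solution_of_schroedinger_solution[OF r lip sol])
    have rf: "r (f x) = c * exp (- (\<beta> * x))" if "b' \<le> x" for x using b'(2)[OF that] c by simp
    have "((\<lambda>x. c * exp (- (\<beta> * x))) has_real_derivative - \<beta> * (c * exp (- (\<beta> * X)))) (at X within {0..})"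
      by (rule derivative_eq_intros refl)+ simp
    then have "((\<lambda>x. r (f x)) has_real_derivative - \<beta> * (c * exp (- (\<beta> * X)))) (at X within {0..})"
      by (rule has_field_derivative_transform_within[where d="X - b'"]) (use X rf in \<open>auto simp: dist_real_def\<close>)
    from vector_derivative_unique_within[OF at_within_half_line_neq_bot[OF X(3)]
        this[unfolded has_real_derivative_iff_has_vector_derivative]
        quasi_solutionD(1)[OF rs X(3), unfolded has_real_derivative_iff_has_vector_derivative]]
    have "s X = - \<beta> * (c * exp (- (\<beta> * X)))" using X(4) by simp
    moreover have "r (f X) * z X - s X * y X = r (f 0) * z 0 - s 0 * y 0"
      using wronskian_constant[OF rs _ X(3)] yz by (auto simp: regular_quasi_solution_def)
    ultimately have "r (f 0) * z 0 - s 0 * y 0 = c * (exp (- (\<beta> * X)) * (z X + \<beta> * y X))"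
      using rf[of X] X by (simp add: algebra_simps)
    also have "exp (- (\<beta> * X)) * (z X + \<beta> * y X) = exp (- (\<beta> * b)) * (z b + \<beta> * y b)"
      using decaying_component_constant[OF W _ X(1)] yz by (auto simp: regular_quasi_solution_def)
    finally show ?thesis
      using y0 z0 by (simp add: s_def algebra_simps)
  qed
  have Re: "Re (f 0) * boundary_slope \<theta> - Re (deriv0 f 0) * boundary_value \<theta> =
      exp (- (\<beta> * b)) * (z b + \<beta> * y b)"
    using *[OF bounded_linear_Re, of 1] by simp
  have Im: "Im (f 0) * boundary_slope \<theta> - Im (deriv0 f 0) * boundary_value \<theta> = 0"
    using *[OF bounded_linear_Im, of 0] by simp
  show ?thesis
    using Re Im unfolding jost_H_def jost_function_def k_def[symmetric] f_def[symmetric]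
    by (auto simp: complex_eq_iff boundary_value_def boundary_slope_def mult.commute)
qed

section \<open>Dependence on the spectral parameter\<close>

lemma decreasing_on_half_line:
  fixes f :: "real \<Rightarrow> real"
  assumes der: "\<And>x. 0 \<le> x \<Longrightarrow> (f has_real_derivative f' x) (at x within {0..})"
    and nonpos: "\<And>x. a < x \<Longrightarrow> x < c \<Longrightarrow> f' x \<le> 0" and ac: "0 \<le> a" "a \<le> c"
  shows "f c \<le> f a"
proof (rule DERIV_nonpos_imp_decreasing_open[OF ac(2)])
  show "\<exists>y. (f has_real_derivative y) (at x) \<and> y \<le> 0" if "a < x" "x < c" for x
  proof -
    have "x \<in> interior {0..}" using that ac by (simp add: interior_real_atLeast)
    then have "at x within {0..} = at x" by (rule at_within_interior)
    then show ?thesis using der[of x] nonpos[OF that] that ac by auto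
  qed
  show "continuous_on {a..c} f"
    by (rule continuous_on_subset[OF continuous_on_half_line_if_derivative[OF der]]) (use ac in auto)
qed

text \<open>The forcing term \<open>h\<close> accounts for the difference of two solutions with different \<open>\<mu>\<close>.\<close>

lemma energy_estimate:
  fixes y z W h :: "real \<Rightarrow> real"
  assumes y: "\<And>x. 0 \<le> x \<Longrightarrow> (y has_real_derivative W x * y x + z x) (at x within {0..})"
    and z: "\<And>x. 0 \<le> x \<Longrightarrow> (z has_real_derivative \<mu> * y x - W x * (W x * y x + z x) + h x) (at x within {0..})"
    and W: "\<And>x. 0 \<le> x \<Longrightarrow> \<bar>W x\<bar> \<le> K" and \<mu>: "\<bar>\<mu>\<bar> \<le> m"
    and h: "\<And>x. 0 \<le> x \<Longrightarrow> x \<le> R \<Longrightarrow> \<bar>h x\<bar> \<le> \<eta>" and x: "0 \<le> x" "x \<le> R"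
  shows "(y x)\<^sup>2 + (z x)\<^sup>2 \<le> ((y 0)\<^sup>2 + (z 0)\<^sup>2 + \<eta>\<^sup>2) * exp ((2 * K + 2 + m + K\<^sup>2) * x)"
proof -
  \<comment> \<open>The coefficients collected after
    \<open>2 * (Y * Z) \<le> Y\<^sup>2 + Z\<^sup>2\<close>: \<open>2 * K\<close> from the diagonal
    terms, \<open>1 + m + K\<^sup>2\<close> from the mixed ones, \<open>1\<close> from the
    forcing.\<close>
  define c where "c = 2 * K + 2 + m + K\<^sup>2"
  have K: "0 \<le> K" using W[of 0] by simp
  have m: "0 \<le> m" using \<mu> by simp
  define E' where "E' x = 2 * y x * (W x * y x + z x) + 2 * z x * (\<mu> * y x - W x * (W x * y x + z x) + h x)" for x
  have E'_le: "E' x \<le> c * ((y x)\<^sup>2 + (z x)\<^sup>2 + \<eta>\<^sup>2)" if x: "0 \<le> x" "x \<le> R" for x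
  proof -
    define Y where "Y = \<bar>y x\<bar>"
    define Z where "Z = \<bar>z x\<bar>"
    have YZ: "2 * (Y * Z) \<le> Y\<^sup>2 + Z\<^sup>2" using sum_squares_bound[of Y Z] by simp
    have h2: "2 * (Z * \<bar>h x\<bar>) \<le> Z\<^sup>2 + \<eta>\<^sup>2"
    proof -
      have "2 * (Z * \<bar>h x\<bar>) \<le> Z\<^sup>2 + \<bar>h x\<bar>\<^sup>2" using sum_squares_bound[of Z "\<bar>h x\<bar>"] by simp
      also have "\<bar>h x\<bar>\<^sup>2 \<le> \<eta>\<^sup>2" using h[OF x] by (intro power_mono) auto
      finally show ?thesis by simp
    qed
    have t1: "2 * (W x * (y x)\<^sup>2) \<le> 2 * (K * Y\<^sup>2)"
      using W[OF x(1)] by (auto simp: Y_def intro!: mult_right_mono)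
    have t2: "2 * (y x * z x) \<le> 2 * (Y * Z)"
      using abs_ge_self[of "y x * z x"] by (simp add: Y_def Z_def abs_mult)
    have t3: "2 * (\<mu> * (y x * z x)) \<le> m * (2 * (Y * Z))"
    proof -
      have "\<mu> * (y x * z x) \<le> \<bar>\<mu>\<bar> * (Y * Z)"
        using abs_ge_self[of "\<mu> * (y x * z x)"] by (simp add: Y_def Z_def abs_mult)
      also have "\<dots> \<le> m * (Y * Z)" using \<mu> by (intro mult_right_mono) (auto simp: Y_def Z_def)
      finally show ?thesis by simp
    qed
    have t4: "- (2 * ((W x)\<^sup>2 * (y x * z x))) \<le> K\<^sup>2 * (2 * (Y * Z))"
    proof -
      have "- ((W x)\<^sup>2 * (y x * z x)) \<le> \<bar>W x\<bar>\<^sup>2 * (Y * Z)"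
        using abs_ge_minus_self[of "(W x)\<^sup>2 * (y x * z x)"] by (simp add: Y_def Z_def abs_mult)
      also have "\<dots> \<le> K\<^sup>2 * (Y * Z)"
        using W[OF x(1)] by (intro mult_right_mono power_mono) (auto simp: Y_def Z_def)
      finally show ?thesis by linarith
    qed
    have t5: "- (2 * (W x * (z x)\<^sup>2)) \<le> 2 * (K * Z\<^sup>2)"
    proof -
      have "(- W x) * (z x)\<^sup>2 \<le> K * (z x)\<^sup>2" using W[OF x(1)] by (intro mult_right_mono) auto
      then show ?thesis by (simp add: Z_def)
    qed
    have t6: "2 * (z x * h x) \<le> 2 * (Z * \<bar>h x\<bar>)"
      using abs_ge_self[of "z x * h x"] by (simp add: Z_def abs_mult)
    have "E' x = 2 * (W x * (y x)\<^sup>2) + 2 * (y x * z x) + 2 * (\<mu> * (y x * z x)) - 2 * ((W x)\<^sup>2 * (y x * z x))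
        - 2 * (W x * (z x)\<^sup>2) + 2 * (z x * h x)"
      by (simp add: E'_def algebra_simps power2_eq_square)
    also have "\<dots> \<le> 2 * (K * Y\<^sup>2) + 2 * (Y * Z) + m * (2 * (Y * Z)) + K\<^sup>2 * (2 * (Y * Z)) + 2 * (K * Z\<^sup>2)
        + 2 * (Z * \<bar>h x\<bar>)"
      using t1 t2 t3 t4 t5 t6 by linarith
    also have "\<dots> \<le> 2 * (K * Y\<^sup>2) + (Y\<^sup>2 + Z\<^sup>2) + m * (Y\<^sup>2 + Z\<^sup>2) + K\<^sup>2 * (Y\<^sup>2 + Z\<^sup>2) + 2 * (K * Z\<^sup>2)
        + (Z\<^sup>2 + \<eta>\<^sup>2)"
      using YZ h2 m K by (intro add_mono mult_left_mono) auto
    also have "\<dots> \<le> c * (Y\<^sup>2 + Z\<^sup>2) + \<eta>\<^sup>2"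
      by (simp add: c_def algebra_simps)
    also have "\<dots> \<le> c * (Y\<^sup>2 + Z\<^sup>2) + c * \<eta>\<^sup>2"
    proof -
      have "1 \<le> c" using K m by (simp add: c_def)
      then have "1 * \<eta>\<^sup>2 \<le> c * \<eta>\<^sup>2" by (intro mult_right_mono) auto
      then show ?thesis by simp
    qed
    finally show ?thesis by (simp add: Y_def Z_def algebra_simps)
  qed
  \<comment> \<open>Gronwall's argument; including \<open>\<eta>\<^sup>2\<close> in the energy makes
    the differential inequality homogeneous.\<close>
  have "exp (- (c * x)) * ((y x)\<^sup>2 + (z x)\<^sup>2 + \<eta>\<^sup>2) \<le> exp (- (c * 0)) * ((y 0)\<^sup>2 + (z 0)\<^sup>2 + \<eta>\<^sup>2)"
  proof (rule decreasing_on_half_line[where f="\<lambda>x. exp (- (c * x)) * ((y x)\<^sup>2 + (z x)\<^sup>2 + \<eta>\<^sup>2)"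
        and f'="\<lambda>x. exp (- (c * x)) * (E' x - c * ((y x)\<^sup>2 + (z x)\<^sup>2 + \<eta>\<^sup>2))"])
    show "((\<lambda>x. exp (- (c * x)) * ((y x)\<^sup>2 + (z x)\<^sup>2 + \<eta>\<^sup>2)) has_real_derivative
       exp (- (c * t)) * (E' t - c * ((y t)\<^sup>2 + (z t)\<^sup>2 + \<eta>\<^sup>2))) (at t within {0..})" if "0 \<le> t" for t
      by (rule derivative_eq_intros y[OF that] z[OF that] refl)+ (simp add: E'_def algebra_simps)
    show "exp (- (c * t)) * (E' t - c * ((y t)\<^sup>2 + (z t)\<^sup>2 + \<eta>\<^sup>2)) \<le> 0" if "0 < t" "t < x" for t
      using E'_le[of t] that x by (intro mult_nonneg_nonpos) auto
  qed (use x in auto)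
  then have "exp (c * x) * (exp (- (c * x)) * ((y x)\<^sup>2 + (z x)\<^sup>2 + \<eta>\<^sup>2))
      \<le> exp (c * x) * ((y 0)\<^sup>2 + (z 0)\<^sup>2 + \<eta>\<^sup>2)"
    by (intro mult_left_mono) auto
  then have "(y x)\<^sup>2 + (z x)\<^sup>2 + \<eta>\<^sup>2 \<le> exp (c * x) * ((y 0)\<^sup>2 + (z 0)\<^sup>2 + \<eta>\<^sup>2)"
    by (simp only: mult.assoc[symmetric] exp_minus_inverse mult_1)
  then have "(y x)\<^sup>2 + (z x)\<^sup>2 \<le> exp (c * x) * ((y 0)\<^sup>2 + (z 0)\<^sup>2 + \<eta>\<^sup>2)"
    using zero_le_power2[of \<eta>] by linarith
  then show ?thesis by (simp add: c_def mult.commute)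
qed

text \<open>The difference of the solutions for \<beta> and \<open>\<beta>0\<close> starts from zero
  and solves the system for \<open>\<beta>0\<close> with forcing
  \<open>(\<beta>\<^sup>2 - \<beta>0\<^sup>2) * Y \<beta>\<close>. The energy estimate first bounds
  \<open>Y \<beta>\<close> and then this difference.\<close>

lemma regular_quasi_solution_lipschitz:
  assumes W: "cutoff_primitive V b W"
    and YZ: "\<And>\<beta>. regular_quasi_solution W \<theta> \<beta> (Y \<beta>) (Z \<beta>)" and R: "0 \<le> R"
  shows "\<exists>C\<ge>0. \<forall>\<beta> x. \<bar>\<beta> - \<beta>0\<bar> \<le> 1 \<longrightarrow> 0 \<le> x \<longrightarrow> x \<le> R \<longrightarrow>
    \<bar>Y \<beta> x - Y \<beta>0 x\<bar> \<le> C * \<bar>\<beta> - \<beta>0\<bar> \<and> \<bar>Z \<beta> x - Z \<beta>0 x\<bar> \<le> C * \<bar>\<beta> - \<beta>0\<bar>"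
proof -
  obtain K where K: "0 \<le> K" "\<And>x. 0 \<le> x \<Longrightarrow> \<bar>W x\<bar> \<le> K" using cutoff_primitive_bounded[OF W] by metis
  define m where "m = (\<bar>\<beta>0\<bar> + 1)\<^sup>2"
  define c where "c = 2 * K + 2 + m + K\<^sup>2"
  have c: "0 \<le> c" using K by (simp add: c_def m_def)
  define M where "M = ((boundary_value \<theta>)\<^sup>2 + (boundary_slope \<theta> - W 0 * boundary_value \<theta>)\<^sup>2 + 0\<^sup>2) * exp (c * R)"
  have M: "0 \<le> M" by (simp add: M_def)
  \<comment> \<open>Square root of the factor in the energy bound for the difference;
    \<open>2 * \<bar>\<beta>0\<bar> + 1\<close> bounds
    \<open>\<bar>\<beta> + \<beta>0\<bar>\<close>.\<close>
  define C where "C = sqrt ((2 * \<bar>\<beta>0\<bar> + 1)\<^sup>2 * M * exp (c * R))"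
  have qs: "quasi_solution W (\<beta>\<^sup>2) (Y \<beta>) (Z \<beta>)" for \<beta>
    using YZ by (simp add: regular_quasi_solution_def)
  have main: "\<bar>Y \<beta> x - Y \<beta>0 x\<bar> \<le> C * \<bar>\<beta> - \<beta>0\<bar> \<and> \<bar>Z \<beta> x - Z \<beta>0 x\<bar> \<le> C * \<bar>\<beta> - \<beta>0\<bar>"
    if \<beta>: "\<bar>\<beta> - \<beta>0\<bar> \<le> 1" and x: "0 \<le> x" "x \<le> R" for \<beta> x
  proof -
    have \<beta>m: "\<bar>\<beta>\<^sup>2\<bar> \<le> m"
    proof -
      have "\<bar>\<beta>\<bar>\<^sup>2 \<le> (\<bar>\<beta>0\<bar> + 1)\<^sup>2" using \<beta> by (intro power_mono) auto
      then show ?thesis by (simp add: m_def)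
    qed
    have \<beta>0m: "\<bar>\<beta>0\<^sup>2\<bar> \<le> m"
    proof -
      have "\<bar>\<beta>0\<bar>\<^sup>2 \<le> (\<bar>\<beta>0\<bar> + 1)\<^sup>2" by (intro power_mono) auto
      then show ?thesis by (simp add: m_def)
    qed
    have Y_le: "(Y \<beta> t)\<^sup>2 \<le> M" if t: "0 \<le> t" "t \<le> R" for t
    proof -
      have "(Y \<beta> t)\<^sup>2 + (Z \<beta> t)\<^sup>2 \<le> ((Y \<beta> 0)\<^sup>2 + (Z \<beta> 0)\<^sup>2 + 0\<^sup>2) * exp ((2 * K + 2 + m + K\<^sup>2) * t)"
      proof (rule energy_estimate[where W=W and \<mu>="\<beta>\<^sup>2" and h="\<lambda>_. 0" and R=R])
        show "(Z \<beta> has_real_derivative \<beta>\<^sup>2 * Y \<beta> s - W s * (W s * Y \<beta> s + Z \<beta> s) + 0) (at s within {0..})"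
          if "0 \<le> s" for s using quasi_solutionD(2)[OF qs that] by simp
      qed (use quasi_solutionD(1)[OF qs] K \<beta>m t in auto)
      also have "\<dots> \<le> M"
        using YZ[of \<beta>] t c unfolding M_def c_def[symmetric]
        by (auto simp: regular_quasi_solution_def intro!: mult_mono mult_left_mono)
      finally show ?thesis using zero_le_power2[of "Z \<beta> t"] by linarith
    qed
    define \<epsilon> where "\<epsilon> = \<beta>\<^sup>2 - \<beta>0\<^sup>2"
    define u where "u t = Y \<beta> t - Y \<beta>0 t" for t
    define v where "v t = Z \<beta> t - Z \<beta>0 t" for t
    have u0: "u 0 = 0" "v 0 = 0"
      using YZ[of \<beta>] YZ[of \<beta>0] by (auto simp: u_def v_def regular_quasi_solution_def)
    have "(u x)\<^sup>2 + (v x)\<^sup>2 \<le> ((u 0)\<^sup>2 + (v 0)\<^sup>2 + (\<bar>\<epsilon>\<bar> * sqrt M)\<^sup>2) * exp ((2 * K + 2 + m + K\<^sup>2) * x)"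
    proof (rule energy_estimate[where W=W and \<mu>="\<beta>0\<^sup>2" and h="\<lambda>t. \<epsilon> * Y \<beta> t" and R=R])
      fix t :: real assume t: "0 \<le> t"
      show "(u has_real_derivative W t * u t + v t) (at t within {0..})"
        unfolding u_def v_def
        by (rule derivative_eq_intros quasi_solutionD(1)[OF qs t] refl)+ (simp add: algebra_simps)
      show "(v has_real_derivative \<beta>0\<^sup>2 * u t - W t * (W t * u t + v t) + \<epsilon> * Y \<beta> t) (at t within {0..})"
        unfolding u_def v_def \<epsilon>_def
        by (rule derivative_eq_intros quasi_solutionD(2)[OF qs t] refl)+ (simp add: algebra_simps)
      assume "t \<le> R"
      then have "\<bar>Y \<beta> t\<bar> \<le> sqrt M" using Y_le[OF t] by (simp add: real_le_rsqrt)
      then show "\<bar>\<epsilon> * Y \<beta> t\<bar> \<le> \<bar>\<epsilon>\<bar> * sqrt M" by (simp add: abs_mult mult_left_mono)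
    qed (use K \<beta>0m x in auto)
    also have "\<dots> = \<epsilon>\<^sup>2 * M * exp (c * x)" using M by (simp add: u0 c_def power_mult_distrib)
    also have "\<dots> \<le> ((2 * \<bar>\<beta>0\<bar> + 1) * \<bar>\<beta> - \<beta>0\<bar>)\<^sup>2 * M * exp (c * R)"
    proof (intro mult_mono)
      have "\<bar>\<epsilon>\<bar> = \<bar>\<beta> + \<beta>0\<bar> * \<bar>\<beta> - \<beta>0\<bar>"
        by (simp add: \<epsilon>_def flip: abs_mult) (simp add: algebra_simps power2_eq_square)
      also have "\<dots> \<le> (2 * \<bar>\<beta>0\<bar> + 1) * \<bar>\<beta> - \<beta>0\<bar>" using \<beta> by (intro mult_right_mono) auto
      finally have "\<bar>\<epsilon>\<bar>\<^sup>2 \<le> ((2 * \<bar>\<beta>0\<bar> + 1) * \<bar>\<beta> - \<beta>0\<bar>)\<^sup>2" by (intro power_mono) auto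
      then show "\<epsilon>\<^sup>2 \<le> ((2 * \<bar>\<beta>0\<bar> + 1) * \<bar>\<beta> - \<beta>0\<bar>)\<^sup>2" by simp
      show "exp (c * x) \<le> exp (c * R)" using c x by (simp add: mult_left_mono)
    qed (use M in auto)
    also have "\<dots> = (C * \<bar>\<beta> - \<beta>0\<bar>)\<^sup>2" using M by (simp add: C_def power_mult_distrib)
    finally have uv: "(u x)\<^sup>2 + (v x)\<^sup>2 \<le> (C * \<bar>\<beta> - \<beta>0\<bar>)\<^sup>2" .
    have Cnn: "0 \<le> C * \<bar>\<beta> - \<beta>0\<bar>" using M by (simp add: C_def)
    have "(u x)\<^sup>2 \<le> (C * \<bar>\<beta> - \<beta>0\<bar>)\<^sup>2" "(v x)\<^sup>2 \<le> (C * \<bar>\<beta> - \<beta>0\<bar>)\<^sup>2"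
      using uv zero_le_power2[of "u x"] zero_le_power2[of "v x"] by linarith+
    then show ?thesis
      using Cnn abs_le_square_iff[of "u x" "C * \<bar>\<beta> - \<beta>0\<bar>"] abs_le_square_iff[of "v x" "C * \<bar>\<beta> - \<beta>0\<bar>"]
      by (simp add: u_def v_def)
  qed
  show ?thesis by (rule exI[of _ C]) (use main M in \<open>auto simp: C_def\<close>)
qed

text \<open>The Wronskian with the solution whose initial data are \<open>(- z 0, y 0)\<close> is
  \<open>(y 0)\<^sup>2 + (z 0)\<^sup>2\<close> at \<open>0\<close> and vanishes at
  \<open>x\<close>.\<close>

lemma quasi_solution_nontrivial:
  assumes W: "cutoff_primitive V b W" and yz: "quasi_solution W \<mu> y z"
    and x: "0 \<le> x" "y x = 0" "z x = 0"
  shows "y 0 = 0 \<and> z 0 = 0"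
proof -
  obtain u v where uv: "quasi_solution W \<mu> u v" "u 0 = - z 0" "v 0 = y 0"
    using quasi_solution_exists[OF W] by blast
  have "(y 0)\<^sup>2 + (z 0)\<^sup>2 = 0"
    using wronskian_constant[OF yz uv(1) x(1)] uv x by (simp add: power2_eq_square)
  then show ?thesis by (simp add: sum_power2_eq_zero_iff)
qed

lemma regular_quasi_solution_nontrivial:
  assumes "cutoff_primitive V b W" "regular_quasi_solution W \<theta> \<beta> y z" "0 \<le> x"
  shows "y x \<noteq> 0 \<or> z x \<noteq> 0"
  using quasi_solution_nontrivial[OF assms(1) _ assms(3), of "\<beta>\<^sup>2" y z] assms(2)
  by (auto simp: regular_quasi_solution_def boundary_value_def boundary_slope_def split: if_splits)

text \<open>With integrating factors \<open>exp (- A)\<close> and \<open>exp A\<close>,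
  nonnegativity of either function makes the other, weighted, nondecreasing. At the first point
  where \<open>\<zeta>\<close> is not positive this contradicts
  \<open>0 < \<zeta> 0\<close>.\<close>

lemma cooperative_system_positive:
  fixes y \<zeta> a c :: "real \<Rightarrow> real"
  assumes y: "\<And>x. 0 \<le> x \<Longrightarrow> (y has_real_derivative a x * y x + \<zeta> x) (at x within {0..})"
    and \<zeta>: "\<And>x. 0 \<le> x \<Longrightarrow> (\<zeta> has_real_derivative c x * y x - a x * \<zeta> x) (at x within {0..})"
    and a: "continuous_on {0..} a" and c: "\<And>x. 0 \<le> x \<Longrightarrow> 0 \<le> c x"
    and init: "0 \<le> y 0" "0 < \<zeta> 0" and x: "0 \<le> x"
  shows "0 \<le> y x \<and> 0 < \<zeta> x"
proof -
  define A where "A x = integral {0..x} a" for x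
  have A: "(A has_real_derivative a x) (at x within {0..})" if "0 \<le> x" for x
    unfolding A_def has_real_derivative_iff_has_vector_derivative
    by (rule integral_has_vector_derivative_half_line[OF a that])
  have y_nonneg: "0 \<le> y t" if t: "0 \<le> t" and pos: "\<And>s. 0 < s \<Longrightarrow> s < t \<Longrightarrow> 0 < \<zeta> s" for t
  proof -
    have "- (exp (- A t) * y t) \<le> - (exp (- A 0) * y 0)"
    proof (rule decreasing_on_half_line[where f="\<lambda>s. - (exp (- A s) * y s)"
          and f'="\<lambda>s. - (exp (- A s) * \<zeta> s)"])
      show "((\<lambda>s. - (exp (- A s) * y s)) has_real_derivative - (exp (- A s) * \<zeta> s)) (at s within {0..})"
        if "0 \<le> s" for s
        by (rule derivative_eq_intros A[OF that] y[OF that] refl)+ (simp add: algebra_simps)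
      show "- (exp (- A s) * \<zeta> s) \<le> 0" if "0 < s" "s < t" for s
        using pos[OF that] by simp
    qed (use t in auto)
    then have "0 \<le> exp (- A t) * y t" using init(1) by (simp add: A_def)
    then show ?thesis by (simp add: zero_le_mult_iff)
  qed
  have "0 < \<zeta> x" if x: "0 \<le> x" for x
  proof (rule ccontr)
    assume "\<not> 0 < \<zeta> x"
    define S where "S = {s \<in> {0..}. \<zeta> s \<le> 0}"
    have "S = {0..} \<inter> \<zeta> -` {..0}" by (auto simp: S_def)
    then have "closed S"
      using continuous_closed_preimage[OF continuous_on_half_line_if_derivative[OF \<zeta>], of "{..0}"] by simp
    have S: "x \<in> S" "bdd_below S" using x \<open>\<not> 0 < \<zeta> x\<close> by (auto simp: S_def intro!: bdd_belowI[of _ 0])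
    define t where "t = Inf S"
    have tS: "t \<in> S" unfolding t_def by (rule closed_contains_Inf) (use S \<open>closed S\<close> in auto)
    then have t: "0 \<le> t" "\<zeta> t \<le> 0" by (auto simp: S_def)
    have pos: "0 < \<zeta> s" if "0 \<le> s" "s < t" for s
    proof (rule ccontr)
      assume "\<not> 0 < \<zeta> s"
      then have "s \<in> S" using that by (simp add: S_def)
      then have "t \<le> s" unfolding t_def by (rule cInf_lower) (rule S(2))
      then show False using that by simp
    qed
    have "- (exp (A t) * \<zeta> t) \<le> - (exp (A 0) * \<zeta> 0)"
    proof (rule decreasing_on_half_line[where f="\<lambda>s. - (exp (A s) * \<zeta> s)"
          and f'="\<lambda>s. - (exp (A s) * (c s * y s))"])
      show "((\<lambda>s. - (exp (A s) * \<zeta> s)) has_real_derivative - (exp (A s) * (c s * y s))) (at s within {0..})"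
        if "0 \<le> s" for s
        by (rule derivative_eq_intros A[OF that] \<zeta>[OF that] refl)+ (simp add: algebra_simps)
      show "- (exp (A s) * (c s * y s)) \<le> 0" if "0 < s" "s < t" for s
        using y_nonneg[of s] pos c[of s] that by simp
    qed (use t in auto)
    then have "0 < exp (A t) * \<zeta> t" using init(2) by (simp add: A_def)
    then show False using t(2) by (simp add: zero_less_mult_iff)
  qed
  then show ?thesis using y_nonneg[OF x] x by simp
qed

section \<open>Reality of \<open>H\<close>, its zeros, and its sign for large \<beta>\<close>

lemma phi_family:
  assumes "cutoff_primitive V b W"
  shows "\<exists>Z. \<forall>\<beta>. regular_quasi_solution W \<theta> \<beta> (phi V \<theta> \<beta>) (Z \<beta>)"
  using phi_regular_quasi_solution[OF assms] by metis

lemma jost_H_real: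
  assumes "cutoff_primitive V b W"
  shows "jost_H V \<theta> \<beta> = of_real (Re (jost_H V \<theta> \<beta>))"
  using jost_H_eq[OF assms] phi_family[OF assms] by (metis Re_complex_of_real)

lemma jost_H_zero_iff:
  assumes W: "cutoff_primitive V b W" and yz: "regular_quasi_solution W \<theta> \<beta> y z"
  shows "jost_H V \<theta> \<beta> = 0 \<longleftrightarrow> z b = - \<beta> * y b"
  unfolding jost_H_eq[OF assms] of_real_eq_0_iff by (auto simp: add_eq_0_iff2)

text \<open>
  For large \<open>\<beta>\<close> the shifted quasi-derivative \<open>\<zeta> = z + L y\<close> and \<open>y\<close> form a cooperative system.
\<close>

lemma jost_H_eventually_positive:
  assumes W: "cutoff_primitive V b W"
  shows "\<exists>B. \<forall>\<beta>\<ge>B. 0 < Re (jost_H V \<theta> \<beta>)"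
proof -
  obtain K where K: "0 \<le> K" "\<And>x. 0 \<le> x \<Longrightarrow> \<bar>W x\<bar> \<le> K" using cutoff_primitive_bounded[OF W] by metis
  obtain Z where Z: "\<And>\<beta>. regular_quasi_solution W \<theta> \<beta> (phi V \<theta> \<beta>) (Z \<beta>)"
    using phi_family[OF W] by blast
  have b: "0 \<le> b" using W by (simp add: cutoff_primitive_def)
  \<comment> \<open>Large enough for \<open>0 < z 0 + L * y 0\<close> when \<open>y 0 = 1\<close>;
    in the Dirichlet case \<open>z 0 = 1\<close> already.\<close>
  define L where "L = \<bar>boundary_slope \<theta> - W 0 * boundary_value \<theta>\<bar> + 1"
  have L: "1 \<le> L" by (simp add: L_def)
  \<comment> \<open>The threshold gives \<open>\<bar>W x - L\<bar> \<le> \<beta>\<close>, hence a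
    nonnegative coupling \<open>\<beta>\<^sup>2 - (W x - L)\<^sup>2\<close>, and also
    \<open>L \<le> \<beta>\<close>, by which \<open>L\<close> is replaced by \<beta> at the
    end.\<close>
  have "0 < Re (jost_H V \<theta> \<beta>)" if \<beta>: "K + L \<le> \<beta>" for \<beta>
  proof -
    define y where "y = phi V \<theta> \<beta>"
    define z where "z = Z \<beta>"
    have yz: "quasi_solution W (\<beta>\<^sup>2) y z" "y 0 = boundary_value \<theta>"
      "z 0 = boundary_slope \<theta> - W 0 * boundary_value \<theta>"
      using Z[of \<beta>] by (auto simp: regular_quasi_solution_def y_def z_def)
    have "0 \<le> y b \<and> 0 < z b + L * y b"
    proof (rule cooperative_system_positive[where \<zeta>="\<lambda>x. z x + L * y x"
          and a="\<lambda>x. W x - L" and c="\<lambda>x. \<beta>\<^sup>2 - (W x - L)\<^sup>2"])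
      fix x :: real assume x: "0 \<le> x"
      show "(y has_real_derivative (W x - L) * y x + (z x + L * y x)) (at x within {0..})"
        using quasi_solutionD(1)[OF yz(1) x] by (simp add: algebra_simps)
      show "((\<lambda>x. z x + L * y x) has_real_derivative
          (\<beta>\<^sup>2 - (W x - L)\<^sup>2) * y x - (W x - L) * (z x + L * y x)) (at x within {0..})"
        by (rule derivative_eq_intros quasi_solutionD[OF yz(1) x] refl)+
          (simp add: algebra_simps power2_eq_square)
      have "\<bar>W x - L\<bar> \<le> \<bar>\<beta>\<bar>" using K(2)[OF x] L K(1) \<beta> by linarith
      then have "(W x - L)\<^sup>2 \<le> \<beta>\<^sup>2" by (simp only: abs_le_square_iff)
      then show "0 \<le> \<beta>\<^sup>2 - (W x - L)\<^sup>2" by simp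
    next
      show "continuous_on {0..} (\<lambda>x. W x - L)"
        by (intro continuous_intros cutoff_primitive_continuous[OF W])
      show "0 \<le> y 0" by (simp add: yz boundary_value_def)
      show "0 < z 0 + L * y 0"
        unfolding yz L_def by (auto simp: boundary_value_def boundary_slope_def)
    qed (rule b)
    then have "0 \<le> y b" "0 < z b + L * y b" by auto
    moreover have "0 \<le> (\<beta> - L) * y b" using calculation(1) \<beta> K(1) by simp
    ultimately have "0 < z b + \<beta> * y b" by (simp add: algebra_simps)
    then show ?thesis
      unfolding jost_H_eq[OF W Z] y_def z_def by simp
  qed
  then show ?thesis by blast
qed

section \<open>Continuity of \<open>H\<close> and its derivative at a zero\<close>

lemma isCont_if_locally_lipschitz:
  fixes f :: "real \<Rightarrow> real"
  assumes "\<And>\<beta>. \<bar>\<beta> - \<beta>0\<bar> \<le> 1 \<Longrightarrow> \<bar>f \<beta> - f \<beta>0\<bar> \<le> C * \<bar>\<beta> - \<beta>0\<bar>"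
  shows "isCont f \<beta>0"
proof -
  have "\<forall>\<^sub>F \<beta> in at \<beta>0. \<bar>\<beta> - \<beta>0\<bar> \<le> 1"
    unfolding eventually_at by (rule exI[of _ 1]) (auto simp: dist_real_def)
  then have "\<forall>\<^sub>F \<beta> in at \<beta>0. norm (f \<beta> - f \<beta>0) \<le> C * \<bar>\<beta> - \<beta>0\<bar>"
    by (rule eventually_mono) (use assms in auto)
  moreover have "((\<lambda>\<beta>. C * \<bar>\<beta> - \<beta>0\<bar>) \<longlongrightarrow> C * \<bar>\<beta>0 - \<beta>0\<bar>) (at \<beta>0)"
    by (intro tendsto_intros)
  ultimately have "((\<lambda>\<beta>. f \<beta> - f \<beta>0) \<longlongrightarrow> 0) (at \<beta>0)"
    by (intro Lim_null_comparison[of "\<lambda>\<beta>. f \<beta> - f \<beta>0"]) auto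
  then show ?thesis by (simp add: isCont_def LIM_zero_iff)
qed

lemma jost_H_continuous:
  assumes W: "cutoff_primitive V b W"
  shows "isCont (\<lambda>\<beta>. Re (jost_H V \<theta> \<beta>)) \<beta>0"
proof -
  have b: "0 \<le> b" using W by (simp add: cutoff_primitive_def)
  obtain Z where Z: "\<And>\<beta>. regular_quasi_solution W \<theta> \<beta> (phi V \<theta> \<beta>) (Z \<beta>)"
    using phi_family[OF W] by blast
  obtain C where C: "\<And>\<beta> x. \<bar>\<beta> - \<beta>0\<bar> \<le> 1 \<Longrightarrow> 0 \<le> x \<Longrightarrow> x \<le> b \<Longrightarrow>
    \<bar>phi V \<theta> \<beta> x - phi V \<theta> \<beta>0 x\<bar> \<le> C * \<bar>\<beta> - \<beta>0\<bar> \<and> \<bar>Z \<beta> x - Z \<beta>0 x\<bar> \<le> C * \<bar>\<beta> - \<beta>0\<bar>"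
    using regular_quasi_solution_lipschitz[OF W Z b, of \<beta>0] by blast
  have "isCont (\<lambda>\<beta>. phi V \<theta> \<beta> b) \<beta>0" "isCont (\<lambda>\<beta>. Z \<beta> b) \<beta>0"
    by (rule isCont_if_locally_lipschitz; use C[OF _ b] in blast)+
  then have "isCont (\<lambda>\<beta>. exp (- (\<beta> * b)) * (Z \<beta> b + \<beta> * phi V \<theta> \<beta> b)) \<beta>0"
    by (intro continuous_intros)
  then show ?thesis unfolding jost_H_eq[OF W Z] by simp
qed

text \<open>
  At a zero \<open>\<beta>0\<close> of \<open>H\<close>, the Wronskian of the regular solutions for \<open>\<beta>0\<close> and \<open>\<beta>\<close> evaluated at \<open>b\<close>
  equals \<open>y b * exp (\<beta> b) * H \<beta> - (\<beta> - \<beta>0) * y b * y\<^sub>\<beta> b\<close>, which exhibits the difference quotient of \<open>H\<close> as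
  a continuous function of \<open>\<beta>\<close>.
\<close>

lemma jost_H_derivative_at_zero:
  assumes W: "cutoff_primitive V b W" and yz: "regular_quasi_solution W \<theta> \<beta>0 y z"
    and H0: "jost_H V \<theta> \<beta>0 = 0"
  shows "y b \<noteq> 0"
    and "((\<lambda>\<beta>. Re (jost_H V \<theta> \<beta>)) has_real_derivative
      exp (- (\<beta>0 * b)) / y b * ((y b)\<^sup>2 + 2 * \<beta>0 * integral {0..b} (\<lambda>x. (y x)\<^sup>2))) (at \<beta>0)"
proof -
  have b: "0 \<le> b" using W by (simp add: cutoff_primitive_def)
  have zb: "z b = - \<beta>0 * y b" using jost_H_zero_iff[OF W yz] H0 by simp
  then show yb: "y b \<noteq> 0" using regular_quasi_solution_nontrivial[OF W yz b] by auto
  obtain Z0 where Z0: "\<And>\<beta>. regular_quasi_solution W \<theta> \<beta> (phi V \<theta> \<beta>) (Z0 \<beta>)"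
    using phi_family[OF W] by blast
  \<comment> \<open>The given \<open>y\<close> is spliced into the family at
    \<open>\<beta>0\<close>, as it may differ from the function
    \<open>phi V \<theta> \<beta>0\<close>.\<close>
  define Y where "Y = (phi V \<theta>)(\<beta>0 := y)"
  define Z where "Z = Z0(\<beta>0 := z)"
  have YZ: "regular_quasi_solution W \<theta> \<beta> (Y \<beta>) (Z \<beta>)" for \<beta>
    using Z0 yz by (simp add: Y_def Z_def)
  have Y0: "Y \<beta>0 = y" by (simp add: Y_def)
  have qs: "quasi_solution W (\<beta>\<^sup>2) (Y \<beta>) (Z \<beta>)" for \<beta> using YZ by (simp add: regular_quasi_solution_def)
  have qs0: "quasi_solution W (\<beta>0\<^sup>2) y z" using yz by (simp add: regular_quasi_solution_def)
  have Y_cont: "continuous_on {0..b} (Y \<beta>)" for \<beta>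
    by (rule continuous_on_subset[OF quasi_solution_continuous(1)[OF qs]]) auto
  have y_cont: "continuous_on {0..b} y" using Y_cont[of \<beta>0] by (simp add: Y0)
  define I where "I \<beta> = integral {0..b} (\<lambda>x. y x * Y \<beta> x)" for \<beta>
  obtain C where C: "0 \<le> C" "\<And>\<beta> x. \<bar>\<beta> - \<beta>0\<bar> \<le> 1 \<Longrightarrow> 0 \<le> x \<Longrightarrow> x \<le> b \<Longrightarrow>
    \<bar>Y \<beta> x - y x\<bar> \<le> C * \<bar>\<beta> - \<beta>0\<bar> \<and> \<bar>Z \<beta> x - Z \<beta>0 x\<bar> \<le> C * \<bar>\<beta> - \<beta>0\<bar>"
    using regular_quasi_solution_lipschitz[OF W YZ b, of \<beta>0] unfolding Y0 by blast
  have "compact (y ` {0..b})" by (intro compact_continuous_image y_cont) auto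
  then have "bounded (y ` {0..b})" by (rule compact_imp_bounded)
  then obtain D where D: "\<forall>v\<in>y ` {0..b}. norm v \<le> D" by (auto simp: bounded_iff)
  have D_nonneg: "0 \<le> D" using D b by (force intro: order_trans[OF norm_ge_zero])
  have "isCont I \<beta>0"
  proof (rule isCont_if_locally_lipschitz)
    fix \<beta> assume \<beta>: "\<bar>\<beta> - \<beta>0\<bar> \<le> 1"
    have "I \<beta> - I \<beta>0 = integral {0..b} (\<lambda>x. y x * (Y \<beta> x - y x))"
      unfolding I_def Y0 right_diff_distrib
      by (intro integral_diff[symmetric] integrable_continuous_real continuous_intros y_cont Y_cont)
    also have "norm \<dots> \<le> integral {0..b} (\<lambda>x. D * (C * \<bar>\<beta> - \<beta>0\<bar>))"
    proof (rule integral_norm_bound_integral)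
      show "(\<lambda>x. y x * (Y \<beta> x - y x)) integrable_on {0..b}"
        by (intro integrable_continuous_real continuous_intros y_cont Y_cont)
      fix x assume x: "x \<in> {0..b}"
      have "\<bar>y x\<bar> \<le> D" using D x by auto
      then show "norm (y x * (Y \<beta> x - y x)) \<le> D * (C * \<bar>\<beta> - \<beta>0\<bar>)"
        using C(2)[OF \<beta>, of x] x D_nonneg by (auto simp: abs_mult intro!: mult_mono)
    qed auto
    also have "\<dots> = (b * D * C) * \<bar>\<beta> - \<beta>0\<bar>" using b by simp
    finally show "\<bar>I \<beta> - I \<beta>0\<bar> \<le> (b * D * C) * \<bar>\<beta> - \<beta>0\<bar>" by simp
  qed
  moreover have "isCont (\<lambda>\<beta>. Y \<beta> b) \<beta>0"
    by (rule isCont_if_locally_lipschitz[of _ _ C]) (use C(2)[OF _ b] in \<open>simp add: Y0\<close>)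
  ultimately have cont: "isCont (\<lambda>\<beta>. exp (- (\<beta> * b)) / y b * (y b * Y \<beta> b + (\<beta> + \<beta>0) * I \<beta>)) \<beta>0"
    by (intro continuous_intros yb)
  \<comment> \<open>Both solutions share their initial data, so their Wronskian starts from
    zero.\<close>
  have wr: "y b * Z \<beta> b - z b * Y \<beta> b = (\<beta>\<^sup>2 - \<beta>0\<^sup>2) * I \<beta>" for \<beta>
  proof -
    have int: "((\<lambda>x. (\<beta>\<^sup>2 - \<beta>0\<^sup>2) * (y x * Y \<beta> x)) has_integral
        (y b * Z \<beta> b - z b * Y \<beta> b) - (y 0 * Z \<beta> 0 - z 0 * Y \<beta> 0)) {0..b}"
      using b by (intro fundamental_theorem_of_calculus)
        (auto simp flip: has_real_derivative_iff_has_vector_derivative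
          intro!: DERIV_subset[OF wronskian_derivative[OF qs0 qs]])
    have "y 0 * Z \<beta> 0 - z 0 * Y \<beta> 0 = 0"
      using yz YZ[of \<beta>] by (simp add: regular_quasi_solution_def)
    then show ?thesis using integral_unique[OF int] by (simp add: I_def)
  qed
  have "Re (jost_H V \<theta> \<beta>) - Re (jost_H V \<theta> \<beta>0) =
      exp (- (\<beta> * b)) / y b * (y b * Y \<beta> b + (\<beta> + \<beta>0) * I \<beta>) * (\<beta> - \<beta>0)" for \<beta>
  proof -
    have "y b * (Z \<beta> b + \<beta> * Y \<beta> b) = (\<beta>\<^sup>2 - \<beta>0\<^sup>2) * I \<beta> + z b * Y \<beta> b + \<beta> * y b * Y \<beta> b"
      using wr[of \<beta>] by (simp add: algebra_simps)
    also have "\<dots> = (\<beta> - \<beta>0) * (y b * Y \<beta> b + (\<beta> + \<beta>0) * I \<beta>)"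
      unfolding zb by (simp add: algebra_simps power2_eq_square)
    finally have "Z \<beta> b + \<beta> * Y \<beta> b = (\<beta> - \<beta>0) * (y b * Y \<beta> b + (\<beta> + \<beta>0) * I \<beta>) / y b"
      using yb by (simp add: eq_divide_eq mult.commute)
    then show ?thesis
      unfolding jost_H_eq[OF W YZ[of \<beta>]] H0 by simp
  qed
  then have "((\<lambda>\<beta>. Re (jost_H V \<theta> \<beta>)) has_real_derivative
      exp (- (\<beta>0 * b)) / y b * (y b * Y \<beta>0 b + (\<beta>0 + \<beta>0) * I \<beta>0)) (at \<beta>0)"
    using cont unfolding CARAT_DERIV
    by (intro exI[of _ "\<lambda>\<beta>. exp (- (\<beta> * b)) / y b * (y b * Y \<beta> b + (\<beta> + \<beta>0) * I \<beta>)"]) auto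
  then show "((\<lambda>\<beta>. Re (jost_H V \<theta> \<beta>)) has_real_derivative
      exp (- (\<beta>0 * b)) / y b * ((y b)\<^sup>2 + 2 * \<beta>0 * integral {0..b} (\<lambda>x. (y x)\<^sup>2))) (at \<beta>0)"
    by (simp add: I_def Y0 power2_eq_square)
qed

section \<open>Removing a bound state\<close>

text \<open>On \<open>(0, pi)\<close> the inverse of \<open>cot\<close> is
  \<open>pi / 2 - arctan\<close>, so the definite description has exactly one candidate.\<close>

lemma shift_boundary_spec:
  assumes "0 < \<theta>" "\<theta> < pi"
  shows "0 < shift_boundary c \<theta>" "shift_boundary c \<theta> < pi" "cot (shift_boundary c \<theta>) = cot \<theta> + c"
proof -
  define P where "P \<theta>' \<longleftrightarrow> 0 < \<theta>' \<and> \<theta>' < pi \<and> cot \<theta>' = cot \<theta> + c" for \<theta>'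
  have tan_eq: "tan (pi / 2 - x) = cot x" for x :: real
    by (simp add: tan_def cot_def sin_diff cos_diff)
  have "\<exists>!\<theta>'. P \<theta>'"
  proof (rule ex1I)
    show "P (pi / 2 - arctan (cot \<theta> + c))"
      using arctan_bounded[of "cot \<theta> + c"] tan_eq[of "pi / 2 - arctan (cot \<theta> + c)"]
      by (simp add: P_def tan_arctan)
    fix \<theta>' assume P: "P \<theta>'"
    then have "arctan (tan (pi / 2 - \<theta>')) = pi / 2 - \<theta>'"
      by (intro arctan_tan) (auto simp: P_def)
    then show "\<theta>' = pi / 2 - arctan (cot \<theta> + c)"
      using P unfolding tan_eq P_def by simp
  qed
  then have "P (THE \<theta>'. P \<theta>')" by (rule theI')
  moreover have "shift_boundary c \<theta> = (THE \<theta>'. P \<theta>')"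
    using assms by (simp add: shift_boundary_def P_def)
  ultimately have "P (shift_boundary c \<theta>)" by simp
  then show "0 < shift_boundary c \<theta>" "shift_boundary c \<theta> < pi" "cot (shift_boundary c \<theta>) = cot \<theta> + c"
    by (auto simp: P_def)
qed

text \<open>
  Here \<open>r = 1 / (1 - G \<integral> u\<^sup>2)\<close>.  The new solution is \<open>y + G u r \<integral> u y\<close>, where \<open>\<integral> u y\<close> is expressed by the
  Wronskian \<open>\<omega>\<close>, and the new potential is \<open>V + 2 G (u\<^sup>2 r)'\<close>.
\<close>

lemma darboux_quasi_solution:
  assumes u: "quasi_solution W (\<gamma>\<^sup>2) u s" and y: "quasi_solution W (\<beta>\<^sup>2) y z"
    and r: "\<And>x. 0 \<le> x \<Longrightarrow> (r has_real_derivative G * (u x)\<^sup>2 * (r x)\<^sup>2) (at x within {0..})"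
    and ne: "\<beta>\<^sup>2 \<noteq> \<gamma>\<^sup>2"
  defines "\<omega> \<equiv> \<lambda>x. (u x * z x - s x * y x) / (\<beta>\<^sup>2 - \<gamma>\<^sup>2)"
  shows "quasi_solution (\<lambda>x. W x + 2 * G * (u x)\<^sup>2 * r x - c) (\<beta>\<^sup>2)
    (\<lambda>x. y x + G * u x * r x * \<omega> x)
    (\<lambda>x. (c - G * (u x)\<^sup>2 * r x) * (y x + G * u x * r x * \<omega> x) + z x + G * s x * r x * \<omega> x)"
  unfolding quasi_solution_def
proof (intro allI impI conjI)
  fix x :: real assume x: "0 \<le> x"
  have \<omega>: "(\<omega> has_real_derivative u x * y x) (at x within {0..})"
    unfolding \<omega>_def using DERIV_cdivide[OF wronskian_derivative[OF u y x], of "\<beta>\<^sup>2 - \<gamma>\<^sup>2"] ne by simp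
  have \<omega>_eq: "u x * z x - s x * y x = (\<beta>\<^sup>2 - \<gamma>\<^sup>2) * \<omega> x" using ne by (simp add: \<omega>_def)
  note ders = quasi_solutionD[OF u x] quasi_solutionD[OF y x] r[OF x] \<omega>
  show "((\<lambda>x. y x + G * u x * r x * \<omega> x) has_real_derivative
      (W x + 2 * G * (u x)\<^sup>2 * r x - c) * (y x + G * u x * r x * \<omega> x) +
      ((c - G * (u x)\<^sup>2 * r x) * (y x + G * u x * r x * \<omega> x) + z x + G * s x * r x * \<omega> x)) (at x within {0..})"
    by (rule derivative_eq_intros ders refl)+ (simp add: algebra_simps power2_eq_square)
  have "((\<lambda>x. (c - G * (u x)\<^sup>2 * r x) * (y x + G * u x * r x * \<omega> x) + z x + G * s x * r x * \<omega> x)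
      has_real_derivative
      (- (G * (2 * u x * (W x * u x + s x) * r x + (u x)\<^sup>2 * (G * (u x)\<^sup>2 * (r x)\<^sup>2)))) *
        (y x + G * u x * r x * \<omega> x) +
      (c - G * (u x)\<^sup>2 * r x) * (W x * y x + z x + G * ((W x * u x + s x) * r x * \<omega> x +
        u x * (G * (u x)\<^sup>2 * (r x)\<^sup>2) * \<omega> x + u x * r x * (u x * y x))) +
      (\<beta>\<^sup>2 * y x - W x * (W x * y x + z x)) +
      G * ((\<gamma>\<^sup>2 * u x - W x * (W x * u x + s x)) * r x * \<omega> x + s x * (G * (u x)\<^sup>2 * (r x)\<^sup>2) * \<omega> x +
        s x * r x * (u x * y x))) (at x within {0..})" (is "(_ has_real_derivative ?D) _")
    by (rule derivative_eq_intros ders refl)+ (simp add: algebra_simps power2_eq_square)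
  \<comment> \<open>The equation for \<open>u\<close> supplies \<open>\<gamma>\<^sup>2\<close> where
    \<open>\<beta>\<^sup>2\<close> is wanted; by \<open>\<omega>_eq\<close> the mismatch
    \<open>(\<beta>\<^sup>2 - \<gamma>\<^sup>2) * G * u x * r x * \<omega> x\<close> is traded for a
    Wronskian, and a polynomial identity remains.\<close>
  moreover have "?D = \<beta>\<^sup>2 * (y x + G * u x * r x * \<omega> x) -
      (W x + 2 * G * (u x)\<^sup>2 * r x - c) *
      ((W x + 2 * G * (u x)\<^sup>2 * r x - c) * (y x + G * u x * r x * \<omega> x) +
       ((c - G * (u x)\<^sup>2 * r x) * (y x + G * u x * r x * \<omega> x) + z x + G * s x * r x * \<omega> x))"
    using \<omega>_eq by algebra
  ultimately show "((\<lambda>x. (c - G * (u x)\<^sup>2 * r x) * (y x + G * u x * r x * \<omega> x) + z x + G * s x * r x * \<omega> x)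
      has_real_derivative \<beta>\<^sup>2 * (y x + G * u x * r x * \<omega> x) -
      (W x + 2 * G * (u x)\<^sup>2 * r x - c) *
      ((W x + 2 * G * (u x)\<^sup>2 * r x - c) * (y x + G * u x * r x * \<omega> x) +
       ((c - G * (u x)\<^sup>2 * r x) * (y x + G * u x * r x * \<omega> x) + z x + G * s x * r x * \<omega> x))) (at x within {0..})"
    by simp
qed

text \<open>The relation between \<open>V'\<close> and \<open>V\<close> is asked for positive
  \<open>x\<close> only: \<open>deriv\<close> at \<open>0\<close> would also see negative arguments,
  where \<open>phi\<close> is arbitrary, and \<open>{0}\<close> is negligible. Subtracting
  \<open>c\<close> restores the normalisation beyond \<open>b\<close>.\<close>

lemma cutoff_primitive_add_derivative:
  assumes W: "cutoff_primitive V b W"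
    and q: "\<And>x. 0 \<le> x \<Longrightarrow> (q has_real_derivative q' x) (at x within {0..})"
    and q'_cont: "continuous_on {0..} q'"
    and V': "\<And>x. 0 < x \<Longrightarrow> V' x = V x + q' x"
    and q_const: "\<And>x. b \<le> x \<Longrightarrow> q x = c" and q'_zero: "\<And>x. b < x \<Longrightarrow> q' x = 0"
  shows "cutoff_primitive V' b (\<lambda>x. W x + q x - c)"
  unfolding cutoff_primitive_def
proof (intro conjI allI impI)
  show b: "0 \<le> b" using W by (simp add: cutoff_primitive_def)
  have "AE x in lebesgue. b < x \<longrightarrow> V x = 0" using W by (simp add: cutoff_primitive_def vanishes_beyond_def)
  then show "vanishes_beyond V' b"
    unfolding vanishes_beyond_def by (rule eventually_mono) (use b V' q'_zero in auto)
  show "W x + q x - c = 0" if "b \<le> x" for x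
    using W q_const that by (simp add: cutoff_primitive_def)
  show "locally_integrable_primitive V' (\<lambda>x. W x + q x - c)"
    unfolding locally_integrable_primitive_def
  proof (intro allI impI conjI)
    fix x :: real assume x: "0 \<le> x"
    have V: "V absolutely_integrable_on {0..x}" "(V has_integral (W x - W 0)) {0..x}"
      using W x by (auto simp: cutoff_primitive_def locally_integrable_primitive_def)
    have "(\<lambda>t. V t + q' t) absolutely_integrable_on {0..x}"
      by (intro set_integral_add V absolutely_integrable_continuous_real continuous_on_subset[OF q'_cont]) auto
    then show "V' absolutely_integrable_on {0..x}"
      by (rule absolutely_integrable_spike[where S="{0}"]) (use V' in auto)
    have "(q' has_integral (q x - q 0)) {0..x}"
      using x by (intro fundamental_theorem_of_calculus)
        (auto simp flip: has_real_derivative_iff_has_vector_derivative intro!: DERIV_subset[OF q])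
    from has_integral_add[OF V(2) this]
    have "((\<lambda>t. V t + q' t) has_integral ((W x + q x - c) - (W 0 + q 0 - c))) {0..x}" by (simp add: algebra_simps)
    then show "(V' has_integral ((W x + q x - c) - (W 0 + q 0 - c))) {0..x}"
      by (rule has_integral_spike[where S="{0}", rotated 2]) (use V' in auto)
  qed
qed

text \<open>\<open>G\<close> normalises the full integral of \<open>u\<^sup>2\<close> to 1, so
  \<open>D x\<close> is \<open>G\<close> times the tail from \<open>x\<close>. Beyond
  \<open>b\<close>, where \<open>u\<close> is a decaying exponential, this tail is
  \<open>(u x)\<^sup>2 / (2 * \<gamma>)\<close>.\<close>

lemma remove_bound_state_denominator:
  assumes W: "cutoff_primitive V b W" and \<gamma>: "0 < \<gamma>" and us: "quasi_solution W (\<gamma>\<^sup>2) u s"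
    and sb: "s b = - \<gamma> * u b" and ub: "u b \<noteq> 0"
  defines "G \<equiv> (1 / sqrt (integral {0..} (\<lambda>x. (u x)\<^sup>2)))\<^sup>2"
  defines "D \<equiv> \<lambda>x. 1 - G * integral {0..x} (\<lambda>x. (u x)\<^sup>2)"
  shows "\<And>x. 0 \<le> x \<Longrightarrow> (D has_real_derivative - (G * (u x)\<^sup>2)) (at x within {0..})"
    and "\<And>x. 0 \<le> x \<Longrightarrow> 0 < D x" and "\<And>x. b \<le> x \<Longrightarrow> G * (u x)\<^sup>2 = 2 * \<gamma> * D x"
proof -
  have b: "0 \<le> b" using W by (simp add: cutoff_primitive_def)
  have u_exp: "s x = - \<gamma> * u x" "u x = u b * exp (- (\<gamma> * (x - b)))" if "b \<le> x" for x
    using exponential_beyond_cutoff[OF W us sb that] by auto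
  have u2_cont: "continuous_on {0..} (\<lambda>x. (u x)\<^sup>2)"
    by (intro continuous_intros quasi_solution_continuous(1)[OF us])
  define P where "P x = integral {0..x} (\<lambda>x. (u x)\<^sup>2)" for x
  have P: "(P has_real_derivative (u x)\<^sup>2) (at x within {0..})" if "0 \<le> x" for x
    unfolding P_def has_real_derivative_iff_has_vector_derivative
    by (rule integral_has_vector_derivative_half_line[OF u2_cont that])
  have u2_int: "(\<lambda>x. (u x)\<^sup>2) integrable_on {0..x}" for x
    by (intro integrable_continuous_real continuous_on_subset[OF u2_cont]) auto
  \<comment> \<open>The full integral of \<open>u\<^sup>2\<close>: the part up to \<open>b\<close>
    plus the exponential tail.\<close>
  define N where "N = P b + (u b)\<^sup>2 / (2 * \<gamma>)"
  have "((\<lambda>x. (u b)\<^sup>2 * exp (2 * \<gamma> * b) * exp (- (2 * \<gamma>) * x)) has_integral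
      (u b)\<^sup>2 * exp (2 * \<gamma> * b) * (exp (- (2 * \<gamma>) * b) / (2 * \<gamma>))) {b..}"
    using \<gamma> by (intro has_integral_mult_right has_integral_exp_minus_to_infinity) auto
  moreover have "(u b)\<^sup>2 * exp (2 * \<gamma> * b) * (exp (- (2 * \<gamma>) * b) / (2 * \<gamma>)) = (u b)\<^sup>2 / (2 * \<gamma>)"
    by (simp flip: exp_add)
  moreover have "(u b)\<^sup>2 * exp (2 * \<gamma> * b) * exp (- (2 * \<gamma>) * x) = (u x)\<^sup>2" if "x \<in> {b..}" for x
  proof -
    have "(u x)\<^sup>2 = (u b)\<^sup>2 * (exp (- (\<gamma> * (x - b))))\<^sup>2"
      using u_exp(2)[of x] that by (simp add: power_mult_distrib)
    also have "(exp (- (\<gamma> * (x - b))))\<^sup>2 = exp (2 * \<gamma> * b) * exp (- (2 * \<gamma>) * x)"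
      by (simp add: power2_eq_square algebra_simps flip: exp_add)
    finally show ?thesis by simp
  qed
  ultimately have tail: "((\<lambda>x. (u x)\<^sup>2) has_integral (u b)\<^sup>2 / (2 * \<gamma>)) {b..}"
    using has_integral_cong[of "{b..}" "\<lambda>x. (u b)\<^sup>2 * exp (2 * \<gamma> * b) * exp (- (2 * \<gamma>) * x)" "\<lambda>x. (u x)\<^sup>2"] by simp
  have "((\<lambda>x. (u x)\<^sup>2) has_integral P b) {0..b}"
    unfolding P_def by (rule integrable_integral[OF u2_int])
  then have "((\<lambda>x. (u x)\<^sup>2) has_integral (P b + (u b)\<^sup>2 / (2 * \<gamma>))) ({0..b} \<union> {b..})"
    using tail by (rule has_integral_Un) (rule negligible_subset[of "{b}"], auto)
  moreover have "{0..b} \<union> {b..} = {0..}" using b by auto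
  ultimately have N: "integral {0..} (\<lambda>x. (u x)\<^sup>2) = N" by (simp add: N_def integral_unique)
  have Pb: "0 \<le> P b" unfolding P_def by (rule integral_nonneg[OF u2_int]) simp
  have ub2: "0 < (u b)\<^sup>2 / (2 * \<gamma>)" using ub \<gamma> by simp
  then have Npos: "0 < N" using Pb by (simp add: N_def)
  then have G: "G = 1 / N" by (simp add: G_def N power_divide)
  have Gpos: "0 < G" using Npos by (simp add: G)
  have D_eq: "D = (\<lambda>x. 1 - G * P x)" by (simp add: D_def P_def)
  show D_der: "(D has_real_derivative - (G * (u x)\<^sup>2)) (at x within {0..})" if "0 \<le> x" for x
    unfolding D_eq by (rule derivative_eq_intros P[OF that] refl)+ simp
  have Db: "G * (u b)\<^sup>2 = 2 * \<gamma> * D b"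
  proof -
    have "D b = (N - P b) / N" using Npos by (simp add: D_eq G field_simps)
    also have "\<dots> = G * ((u b)\<^sup>2 / (2 * \<gamma>))" by (simp add: N_def G)
    finally show ?thesis using \<gamma> by simp
  qed
  show tail_eq: "G * (u x)\<^sup>2 = 2 * \<gamma> * D x" if x: "b \<le> x" for x
  proof -
    have "G * (u x)\<^sup>2 - 2 * \<gamma> * D x = G * (u b)\<^sup>2 - 2 * \<gamma> * D b"
    proof (rule constant_on_ray[of b "\<lambda>x. G * (u x)\<^sup>2 - 2 * \<gamma> * D x", OF _ b x])
      fix x assume x: "b \<le> x"
      then have x0: "0 \<le> x" and Wx: "W x = 0" using b W by (auto simp: cutoff_primitive_def)
      show "((\<lambda>x. G * (u x)\<^sup>2 - 2 * \<gamma> * D x) has_real_derivative 0) (at x within {0..})"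
        by (rule derivative_eq_intros quasi_solutionD(1)[OF us x0] D_der[OF x0] refl)+
          (simp add: u_exp(1)[OF x] Wx power2_eq_square)
    qed
    then show ?thesis using Db by simp
  qed
  have D_tail_pos: "0 < D x" if x: "b \<le> x" for x
  proof -
    have "0 < G * (u x)\<^sup>2" using u_exp(2)[OF x] ub Gpos by simp
    then show ?thesis using tail_eq[OF x] \<gamma> by (simp add: zero_less_mult_iff)
  qed
  show "0 < D x" if x: "0 \<le> x" for x
  proof (cases "b \<le> x")
    case False
    have "D b \<le> D x"
      by (rule decreasing_on_half_line[OF D_der]) (use False x Gpos in auto)
    then show ?thesis using D_tail_pos[of b] by simp
  qed (rule D_tail_pos)
qed

text \<open>The value of the new Jost function at \<open>\<gamma>\<close> itself is obtained by continuity from the simple zero.\<close>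

lemma remove_bound_state_spec:
  assumes W: "cutoff_primitive V b W" and \<theta>: "0 < \<theta>" "\<theta> \<le> pi" and \<gamma>: "0 < \<gamma>"
    and zero: "jost_H V \<theta> \<gamma> = 0" and rem: "remove_bound_state \<gamma> (V, \<theta>) = (V', \<theta>')"
  shows "\<exists>W'. cutoff_primitive V' b W'" and "0 < \<theta>'" and "\<theta>' \<le> pi"
    and "\<And>\<beta>. \<beta> \<noteq> \<gamma> \<Longrightarrow> \<beta> \<noteq> - \<gamma> \<Longrightarrow> jost_H V' \<theta>' \<beta> = of_real ((\<beta> + \<gamma>) / (\<beta> - \<gamma>)) * jost_H V \<theta> \<beta>"
    and "jost_H V' \<theta>' \<gamma> \<noteq> 0"
proof -
  have b: "0 \<le> b" using W by (simp add: cutoff_primitive_def)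
  define u where "u = phi V \<theta> \<gamma>"
  obtain s where s: "regular_quasi_solution W \<theta> \<gamma> u s"
    using phi_regular_quasi_solution[OF W] unfolding u_def by blast
  have us: "quasi_solution W (\<gamma>\<^sup>2) u s" using s by (simp add: regular_quasi_solution_def)
  have sb: "s b = - \<gamma> * u b" using jost_H_zero_iff[OF W s] zero by simp
  have ub: "u b \<noteq> 0" using jost_H_derivative_at_zero(1)[OF W s zero] .
  define G where "G = (1 / sqrt (integral {0..} (\<lambda>x. (u x)\<^sup>2)))\<^sup>2"
  define D where "D x = 1 - G * integral {0..x} (\<lambda>x. (u x)\<^sup>2)" for x
  note denom = remove_bound_state_denominator[OF W \<gamma> us sb ub, folded G_def, folded D_def]
  define q where "q x = G * (u x)\<^sup>2 / D x" for x
  define q' where "q' x = 2 * G * u x * (W x * u x + s x) / D x + (q x)\<^sup>2" for x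
  have q: "(q has_real_derivative q' x) (at x within {0..})" if x: "0 \<le> x" for x
    unfolding q_def[abs_def] using denom(2)[OF x]
    by (auto intro!: derivative_eq_intros denom(1)[OF x] quasi_solutionD(1)[OF us x]
        simp: q'_def q_def field_simps power2_eq_square)
  have D_cont: "continuous_on {0..} D" by (rule continuous_on_half_line_if_derivative[OF denom(1)])
  have q'_cont: "continuous_on {0..} q'"
    unfolding q'_def using denom(2)
    by (intro continuous_intros quasi_solution_continuous[OF us] cutoff_primitive_continuous[OF W] D_cont
        continuous_on_half_line_if_derivative[OF q]) force+
  \<comment> \<open>Constancy of \<open>q\<close> is what preserves the support, since the potential
    changes by \<open>2 * q'\<close>; it also fixes the constant \<open>4 * \<gamma>\<close> by
    which the new primitive is lowered.\<close>
  have q_tail: "q x = 2 * \<gamma>" if "b \<le> x" for x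
    using denom(3)[OF that] denom(2)[of x] b that by (simp add: q_def)
  have q'_tail: "q' x = 0" if x: "b < x" for x
  proof -
    have "W x = 0" "s x = - \<gamma> * u x"
      using W x exponential_beyond_cutoff(1)[OF W us sb, of x] by (auto simp: cutoff_primitive_def)
    then have "q' x = - 2 * \<gamma> * q x + (q x)\<^sup>2"
      by (simp add: q'_def q_def power2_eq_square)
    then show ?thesis using q_tail[of x] x by (simp add: power2_eq_square)
  qed
  have V'_eq: "V' x = V x + 2 * q' x" if x: "0 < x" for x
  proof -
    have "x \<in> interior {0..}" using x by (simp add: interior_real_atLeast)
    then have "at x within {0..} = at x" by (rule at_within_interior)
    then have "((\<lambda>x. 2 * q x) has_real_derivative 2 * q' x) (at x)"
      using DERIV_cmult[OF q[of x], of 2] x by simp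
    then have "deriv (\<lambda>x. 2 * q x) x = 2 * q' x" by (rule DERIV_imp_deriv)
    moreover have "V' x = V x + deriv (\<lambda>x. 2 * q x) x"
      using rem
      by (auto simp: remove_bound_state_def norming_constant_def Let_def q_def D_def G_def u_def mult.assoc)
    ultimately show ?thesis by simp
  qed
  define W' where "W' x = W x + 2 * q x - 2 * (2 * \<gamma>)" for x
  have W': "cutoff_primitive V' b W'"
    unfolding W'_def
  proof (rule cutoff_primitive_add_derivative[OF W, where q'="\<lambda>x. 2 * q' x"])
    show "((\<lambda>x. 2 * q x) has_real_derivative 2 * q' x) (at x within {0..})" if "0 \<le> x" for x
      by (rule DERIV_cmult[OF q[OF that]])
    show "continuous_on {0..} (\<lambda>x. 2 * q' x)" by (intro continuous_intros q'_cont)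
  qed (use V'_eq q_tail q'_tail in auto)
  then show "\<exists>W'. cutoff_primitive V' b W'" by blast
  have \<theta>'_eq: "\<theta>' = shift_boundary (- G) \<theta>"
    using rem by (simp add: remove_bound_state_def norming_constant_def Let_def G_def u_def)
  show "0 < \<theta>'" "\<theta>' \<le> pi"
    using shift_boundary_spec[of \<theta> "- G"] \<theta> \<theta>'_eq by (cases "\<theta> = pi"; auto simp: shift_boundary_def less_le)+
  have bv: "boundary_value \<theta>' = boundary_value \<theta>"
    and bs: "boundary_slope \<theta>' = boundary_slope \<theta> + G * boundary_value \<theta>"
    using shift_boundary_spec[of \<theta> "- G"] \<theta> \<theta>'_eq
    by (cases "\<theta> = pi"; auto simp: boundary_value_def boundary_slope_def shift_boundary_def less_le)+
  define r where "r x = 1 / D x" for x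
  have r: "(r has_real_derivative G * (u x)\<^sup>2 * (r x)\<^sup>2) (at x within {0..})" if x: "0 \<le> x" for x
    unfolding r_def[abs_def] using denom(2)[OF x]
    by (auto intro!: derivative_eq_intros denom(1)[OF x] simp: power2_eq_square)
  show factor: "jost_H V' \<theta>' \<beta> = of_real ((\<beta> + \<gamma>) / (\<beta> - \<gamma>)) * jost_H V \<theta> \<beta>"
    if \<beta>: "\<beta> \<noteq> \<gamma>" "\<beta> \<noteq> - \<gamma>" for \<beta>
  proof -
    have ne: "\<beta>\<^sup>2 \<noteq> \<gamma>\<^sup>2" using \<beta> by (simp add: power2_eq_iff)
    define y where "y = phi V \<theta> \<beta>"
    obtain z where z: "regular_quasi_solution W \<theta> \<beta> y z"
      using phi_regular_quasi_solution[OF W] unfolding y_def by blast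
    then have yz: "quasi_solution W (\<beta>\<^sup>2) y z" by (simp add: regular_quasi_solution_def)
    define \<omega> where "\<omega> x = (u x * z x - s x * y x) / (\<beta>\<^sup>2 - \<gamma>\<^sup>2)" for x
    define y' where "y' x = y x + G * u x * r x * \<omega> x" for x
    define z' where "z' x = (4 * \<gamma> - G * (u x)\<^sup>2 * r x) * y' x + z x + G * s x * r x * \<omega> x" for x
    have "quasi_solution (\<lambda>x. W x + 2 * G * (u x)\<^sup>2 * r x - 4 * \<gamma>) (\<beta>\<^sup>2) y' z'"
      using darboux_quasi_solution[OF us yz r ne, of "4 * \<gamma>"]
      unfolding y'_def[abs_def] z'_def[abs_def] \<omega>_def[abs_def] by simp
    moreover have "(\<lambda>x. W x + 2 * G * (u x)\<^sup>2 * r x - 4 * \<gamma>) = W'"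
      by (auto simp: W'_def q_def r_def)
    ultimately have qs': "quasi_solution W' (\<beta>\<^sup>2) y' z'" by simp
    have init: "u 0 = boundary_value \<theta>" "s 0 = boundary_slope \<theta> - W 0 * boundary_value \<theta>"
      "y 0 = boundary_value \<theta>" "z 0 = boundary_slope \<theta> - W 0 * boundary_value \<theta>" "r 0 = 1" "q 0 = G * (boundary_value \<theta>)\<^sup>2"
      using s z by (auto simp: regular_quasi_solution_def r_def D_def q_def)
    have \<omega>0: "\<omega> 0 = 0" by (simp add: \<omega>_def init)
    have "regular_quasi_solution W' \<theta>' \<beta> y' z'"
      unfolding regular_quasi_solution_def
    proof (intro conjI qs')
      show "y' 0 = boundary_value \<theta>'" by (simp add: y'_def init \<omega>0 bv)
      have "z' 0 = (4 * \<gamma> - G * (boundary_value \<theta>)\<^sup>2) * boundary_value \<theta> + (boundary_slope \<theta> - W 0 * boundary_value \<theta>)"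
        by (simp add: z'_def y'_def init \<omega>0)
      also have "\<dots> = boundary_slope \<theta>' - W' 0 * boundary_value \<theta>'"
        unfolding bv bs W'_def init by (auto simp: boundary_value_def)
      finally show "z' 0 = boundary_slope \<theta>' - W' 0 * boundary_value \<theta>'" .
    qed
    from jost_H_eq[OF W' this]
    have H': "jost_H V' \<theta>' \<beta> = of_real (exp (- (\<beta> * b)) * (z' b + \<beta> * y' b))" .
    have qb: "G * (u b)\<^sup>2 * r b = 2 * \<gamma>" using q_tail[of b] by (simp add: q_def r_def)
    define e where "e = (z b + \<gamma> * y b) / (\<beta>\<^sup>2 - \<gamma>\<^sup>2)"
    have e: "z b + \<gamma> * y b = (\<beta>\<^sup>2 - \<gamma>\<^sup>2) * e" using ne by (simp add: e_def)
    have \<omega>b: "\<omega> b = u b * e"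
      by (simp add: \<omega>_def e_def sb algebra_simps)
    have "y' b = y b + (G * (u b)\<^sup>2 * r b) * e"
      by (simp add: y'_def \<omega>b power2_eq_square)
    then have y'b: "y' b = y b + 2 * \<gamma> * e" unfolding qb .
    have "G * s b * r b * \<omega> b = - \<gamma> * (G * (u b)\<^sup>2 * r b) * e"
      by (simp add: \<omega>b sb power2_eq_square)
    then have z'b: "z' b = 2 * \<gamma> * y' b + z b - 2 * \<gamma>\<^sup>2 * e"
      unfolding z'_def qb by (simp add: power2_eq_square)
    have "(\<beta> - \<gamma>) * (z' b + \<beta> * y' b) = (\<beta> + \<gamma>) * (z b + \<beta> * y b)"
      unfolding z'b y'b using e by algebra
    then have "z' b + \<beta> * y' b = (\<beta> + \<gamma>) / (\<beta> - \<gamma>) * (z b + \<beta> * y b)"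
      using \<beta> by (simp add: field_simps)
    then show ?thesis
      unfolding H' jost_H_eq[OF W z] by simp
  qed
  define d where "d = exp (- (\<gamma> * b)) / u b * ((u b)\<^sup>2 + 2 * \<gamma> * integral {0..b} (\<lambda>x. (u x)\<^sup>2))"
  \<comment> \<open>As \<gamma> is positive, both terms of the derivative formula have the sign of
    \<open>u b\<close>: the zero is simple.\<close>
  have d: "d \<noteq> 0"
  proof -
    have "0 \<le> integral {0..b} (\<lambda>x. (u x)\<^sup>2)"
      by (rule integral_nonneg)
        (auto intro!: integrable_continuous_real continuous_intros
          continuous_on_subset[OF quasi_solution_continuous(1)[OF us]])
    then have "0 \<le> 2 * \<gamma> * integral {0..b} (\<lambda>x. (u x)\<^sup>2)" using \<gamma> by simp
    moreover have "0 < (u b)\<^sup>2" using ub by simp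
    ultimately have "0 < (u b)\<^sup>2 + 2 * \<gamma> * integral {0..b} (\<lambda>x. (u x)\<^sup>2)" by linarith
    then show ?thesis using ub by (simp add: d_def)
  qed
  have "((\<lambda>\<beta>. Re (jost_H V \<theta> \<beta>)) has_real_derivative d) (at \<gamma>)"
    unfolding d_def by (rule jost_H_derivative_at_zero(2)[OF W s zero])
  then have "((\<lambda>\<beta>. (Re (jost_H V \<theta> \<beta>) - Re (jost_H V \<theta> \<gamma>)) / (\<beta> - \<gamma>)) \<longlongrightarrow> d) (at \<gamma>)"
    by (simp add: has_field_derivative_iff)
  then have "((\<lambda>\<beta>. (\<beta> + \<gamma>) * ((Re (jost_H V \<theta> \<beta>) - Re (jost_H V \<theta> \<gamma>)) / (\<beta> - \<gamma>))) \<longlongrightarrow> (\<gamma> + \<gamma>) * d) (at \<gamma>)"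
    by (intro tendsto_intros)
  moreover have "\<forall>\<^sub>F \<beta> in at \<gamma>. (\<beta> + \<gamma>) * ((Re (jost_H V \<theta> \<beta>) - Re (jost_H V \<theta> \<gamma>)) / (\<beta> - \<gamma>)) =
      Re (jost_H V' \<theta>' \<beta>)"
    unfolding eventually_at
  \<comment> \<open>Radius \<gamma> keeps \<beta> positive and so away from
    \<open>- \<gamma>\<close>, which \<open>factor\<close> excludes.\<close>
  proof (intro exI[of _ \<gamma>] conjI ballI impI \<gamma>)
    fix \<beta> assume "\<beta> \<noteq> \<gamma> \<and> dist \<beta> \<gamma> < \<gamma>"
    then have "\<beta> \<noteq> \<gamma>" "\<beta> \<noteq> - \<gamma>" using \<gamma> by (auto simp: dist_real_def)
    then show "(\<beta> + \<gamma>) * ((Re (jost_H V \<theta> \<beta>) - Re (jost_H V \<theta> \<gamma>)) / (\<beta> - \<gamma>)) = Re (jost_H V' \<theta>' \<beta>)"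
      unfolding factor[OF \<open>\<beta> \<noteq> \<gamma>\<close> \<open>\<beta> \<noteq> - \<gamma>\<close>] Re_complex_of_real zero by simp
  qed
  ultimately have "((\<lambda>\<beta>. Re (jost_H V' \<theta>' \<beta>)) \<longlongrightarrow> (\<gamma> + \<gamma>) * d) (at \<gamma>)"
    by (rule Lim_transform_eventually)
  moreover have "((\<lambda>\<beta>. Re (jost_H V' \<theta>' \<beta>)) \<longlongrightarrow> Re (jost_H V' \<theta>' \<gamma>)) (at \<gamma>)"
    using jost_H_continuous[OF W'] by (simp add: isCont_def)
  ultimately have "Re (jost_H V' \<theta>' \<gamma>) = (\<gamma> + \<gamma>) * d"
    using LIM_unique by blast
  then show "jost_H V' \<theta>' \<gamma> \<noteq> 0" using d \<gamma> by auto
qed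

text \<open>The induction carries the exact set of positive zeros, because each removal needs its
  \<gamma> to be a zero that is still present; injectivity keeps the removed one out of the rest.
  The factorisation is confined to \<beta> off all \<open>\<gamma> s\<close> and
  \<open>- \<gamma> s\<close>, where no Darboux step divides by zero.\<close>

lemma remove_bound_states_spec:
  assumes "cutoff_primitive V b W" and "0 < \<theta>" "\<theta> \<le> pi"
    and "inj_on \<gamma> {1..j}" and "\<And>s. s \<in> {1..j} \<Longrightarrow> 0 < \<gamma> s"
    and "\<And>\<beta>. 0 < \<beta> \<Longrightarrow> jost_H V \<theta> \<beta> = 0 \<longleftrightarrow> \<beta> \<in> \<gamma> ` {1..j}"
    and "remove_bound_states \<gamma> j (V, \<theta>) = (V0, \<theta>0)"
  shows "(\<exists>W0. cutoff_primitive V0 b W0) \<and> (\<forall>\<beta>>0. jost_H V0 \<theta>0 \<beta> \<noteq> 0) \<and>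
    (\<forall>\<beta>. (\<forall>s\<in>{1..j}. \<beta> \<noteq> \<gamma> s \<and> \<beta> \<noteq> - \<gamma> s) \<longrightarrow>
      jost_H V0 \<theta>0 \<beta> = of_real (\<Prod>s\<in>{1..j}. (\<beta> + \<gamma> s) / (\<beta> - \<gamma> s)) * jost_H V \<theta> \<beta>)"
  using assms
proof (induction j arbitrary: V \<theta> W)
  case 0
  then show ?case by auto
next
  case (Suc j)
  define \<kappa> where "\<kappa> = \<gamma> (Suc j)"
  have \<kappa>: "0 < \<kappa>" using Suc.prems(5)[of "Suc j"] by (simp add: \<kappa>_def)
  obtain V' \<theta>' where rem: "remove_bound_state \<kappa> (V, \<theta>) = (V', \<theta>')" by force
  have zero: "jost_H V \<theta> \<kappa> = 0" using Suc.prems(6)[OF \<kappa>] by (auto simp: \<kappa>_def)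
  note step = remove_bound_state_spec[OF Suc.prems(1,2,3) \<kappa> zero rem]
  obtain W' where W': "cutoff_primitive V' b W'" using step(1) by blast
  have \<kappa>_notin: "\<kappa> \<notin> \<gamma> ` {1..j}"
  proof
    assume "\<kappa> \<in> \<gamma> ` {1..j}"
    then obtain s where "s \<in> {1..j}" "\<gamma> (Suc j) = \<gamma> s" by (auto simp: \<kappa>_def)
    with inj_onD[OF Suc.prems(4), of "Suc j" s] show False by simp
  qed
  have zeros: "jost_H V' \<theta>' \<beta> = 0 \<longleftrightarrow> \<beta> \<in> \<gamma> ` {1..j}" if \<beta>: "0 < \<beta>" for \<beta>
  proof (cases "\<beta> = \<kappa>")
    case True
    then show ?thesis using step(5) \<kappa>_notin by simp
  next
    case False
    have ne: "\<beta> \<noteq> - \<kappa>" "\<beta> + \<kappa> \<noteq> 0" using \<beta> \<kappa> by auto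
    have "complex_of_real ((\<beta> + \<kappa>) / (\<beta> - \<kappa>)) \<noteq> 0"
      unfolding of_real_eq_0_iff using ne False by simp
    then have "jost_H V' \<theta>' \<beta> = 0 \<longleftrightarrow> jost_H V \<theta> \<beta> = 0"
      unfolding step(4)[OF False ne(1)] by simp
    also have "\<dots> \<longleftrightarrow> \<beta> \<in> \<gamma> ` {1..Suc j}" by (rule Suc.prems(6)[OF \<beta>])
    also have "\<dots> \<longleftrightarrow> \<beta> \<in> \<gamma> ` {1..j}" using False by (auto simp: \<kappa>_def atLeastAtMostSuc_conv)
    finally show ?thesis .
  qed
  have IH: "(\<exists>W0. cutoff_primitive V0 b W0) \<and> (\<forall>\<beta>>0. jost_H V0 \<theta>0 \<beta> \<noteq> 0) \<and>
    (\<forall>\<beta>. (\<forall>s\<in>{1..j}. \<beta> \<noteq> \<gamma> s \<and> \<beta> \<noteq> - \<gamma> s) \<longrightarrow>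
      jost_H V0 \<theta>0 \<beta> = of_real (\<Prod>s\<in>{1..j}. (\<beta> + \<gamma> s) / (\<beta> - \<gamma> s)) * jost_H V' \<theta>' \<beta>)"
  proof (rule Suc.IH[OF W' step(2,3) _ _ zeros])
    show "inj_on \<gamma> {1..j}" by (rule inj_on_subset[OF Suc.prems(4)]) auto
    show "0 < \<gamma> s" if "s \<in> {1..j}" for s using Suc.prems(5)[of s] that by simp
    show "remove_bound_states \<gamma> j (V', \<theta>') = (V0, \<theta>0)"
      using Suc.prems(7) rem by (simp add: \<kappa>_def)
  qed
  moreover have "jost_H V0 \<theta>0 \<beta> = of_real (\<Prod>s\<in>{1..Suc j}. (\<beta> + \<gamma> s) / (\<beta> - \<gamma> s)) * jost_H V \<theta> \<beta>"
    if \<beta>: "\<forall>s\<in>{1..Suc j}. \<beta> \<noteq> \<gamma> s \<and> \<beta> \<noteq> - \<gamma> s" for \<beta>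
  proof -
    have "\<beta> \<noteq> \<kappa>" "\<beta> \<noteq> - \<kappa>" using \<beta> by (auto simp: \<kappa>_def)
    from step(4)[OF this]
    have 1: "jost_H V' \<theta>' \<beta> = of_real ((\<beta> + \<kappa>) / (\<beta> - \<kappa>)) * jost_H V \<theta> \<beta>" .
    have "\<forall>s\<in>{1..j}. \<beta> \<noteq> \<gamma> s \<and> \<beta> \<noteq> - \<gamma> s" using \<beta> by simp
    then have 2: "jost_H V0 \<theta>0 \<beta> = of_real (\<Prod>s\<in>{1..j}. (\<beta> + \<gamma> s) / (\<beta> - \<gamma> s)) * jost_H V' \<theta>' \<beta>"
      using IH by blast
    have "(\<Prod>s\<in>{1..Suc j}. (\<beta> + \<gamma> s) / (\<beta> - \<gamma> s)) =
        (\<Prod>s\<in>{1..j}. (\<beta> + \<gamma> s) / (\<beta> - \<gamma> s)) * ((\<beta> + \<kappa>) / (\<beta> - \<kappa>))"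
      by (simp add: \<kappa>_def)
    then show ?thesis unfolding 1 2 by simp
  qed
  ultimately show ?case by blast
qed

lemma jost_H_positive_if_no_zeros:
  assumes W: "cutoff_primitive V b W" and nz: "\<And>\<beta>. 0 < \<beta> \<Longrightarrow> jost_H V \<theta> \<beta> \<noteq> 0" and \<kappa>: "0 < \<kappa>"
  shows "0 < Re (jost_H V \<theta> \<kappa>)"
proof (rule ccontr)
  assume neg: "\<not> 0 < Re (jost_H V \<theta> \<kappa>)"
  obtain B where B: "\<And>\<beta>. B \<le> \<beta> \<Longrightarrow> 0 < Re (jost_H V \<theta> \<beta>)"
    using jost_H_eventually_positive[OF W] by blast
  have "\<exists>\<beta>\<ge>\<kappa>. \<beta> \<le> max B \<kappa> \<and> Re (jost_H V \<theta> \<beta>) = 0"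
    using neg B[of "max B \<kappa>"] jost_H_continuous[OF W] by (intro IVT) auto
  then obtain \<beta> where \<beta>: "\<kappa> \<le> \<beta>" "Re (jost_H V \<theta> \<beta>) = 0" by blast
  have "jost_H V \<theta> \<beta> = 0" by (subst jost_H_real[OF W]) (simp add: \<beta>(2))
  then show False using nz[of \<beta>] \<beta>(1) \<kappa> by simp
qed

section \<open>Adding a bound state\<close>

lemma derivative_zero_if_constant_beyond:
  fixes f :: "real \<Rightarrow> real"
  assumes f: "(f has_real_derivative f') (at x within {0..})" and "0 \<le> b" "b < x"
    and const: "\<And>t. b \<le> t \<Longrightarrow> f t = c"
  shows "f' = 0"
proof -
  have "x \<in> interior {0..}" using assms by (simp add: interior_real_atLeast)
  then have "at x within {0..} = at x" by (rule at_within_interior)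
  then have "(f has_real_derivative f') (at x)" using f by simp
  moreover have "(f has_real_derivative 0) (at x)"
    by (rule has_field_derivative_transform_within[OF DERIV_const[of c], of "x - b"])
      (use assms in \<open>auto simp: dist_real_def\<close>)
  ultimately show ?thesis by (rule DERIV_unique)
qed

text \<open>For continuous \<open>f\<close> the exceptional set is open, and a negligible open set
  is empty.\<close>

lemma vanishes_beyond_continuous_iff:
  fixes f :: "real \<Rightarrow> real"
  assumes f: "continuous_on {0..} f" and b: "0 \<le> b"
  shows "vanishes_beyond f b \<longleftrightarrow> (\<forall>x>b. f x = 0)"
proof
  assume "vanishes_beyond f b"
  then have N: "negligible {x. \<not> (b < x \<longrightarrow> f x = 0)}"
    by (simp only: vanishes_beyond_def AE_lebesgue_iff_negligible)
  have "continuous_on {b<..} f" by (rule continuous_on_subset[OF f]) (use b in auto)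
  then have "open ({b<..} \<inter> f -` (- {0}))"
    by (rule continuous_open_preimage) auto
  moreover have "{b<..} \<inter> f -` (- {0}) = {x. \<not> (b < x \<longrightarrow> f x = 0)}" by auto
  ultimately have "{x. \<not> (b < x \<longrightarrow> f x = 0)} = {}"
    using N open_not_negligible by metis
  then show "\<forall>x>b. f x = 0" by blast
qed (simp add: vanishes_beyond_def)

text \<open>
  With \<open>D = 1 + g\<^sup>2 \<integral> y\<^sup>2\<close>, the new potential vanishes beyond \<open>b\<close> iff \<open>2 D' / D\<close> is constant there, i.e. iff
  \<open>y\<^sup>2\<close> is proportional to \<open>D\<close>.  Then \<open>y\<close> is a pure exponential, and it must be the growing one because
  \<open>D \<ge> 1\<close>; comparing \<open>g\<^sup>2 y\<^sup>2\<close> with \<open>2 \<kappa> D\<close> at \<open>b\<close> determines \<open>g\<close>.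
\<close>

lemma add_bound_state_vanishes_beyond_iff:
  assumes W: "cutoff_primitive V b W" and \<kappa>: "0 < \<kappa>"
    and yz: "regular_quasi_solution W \<theta> \<kappa> (phi V \<theta> \<kappa>) z"
  shows "(\<exists>g>0. vanishes_beyond (fst (add_bound_state \<kappa> g (V, \<theta>))) b) \<longleftrightarrow>
    z b = \<kappa> * phi V \<theta> \<kappa> b \<and> 2 * \<kappa> * integral {0..b} (\<lambda>x. (phi V \<theta> \<kappa> x)\<^sup>2) < (phi V \<theta> \<kappa> b)\<^sup>2"
proof -
  have b: "0 \<le> b" and V_zero: "vanishes_beyond V b" and W_zero: "\<And>x. b \<le> x \<Longrightarrow> W x = 0"
    using W by (auto simp: cutoff_primitive_def)
  define y where "y = phi V \<theta> \<kappa>"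
  have qs: "quasi_solution W (\<kappa>\<^sup>2) y z" using yz by (simp add: regular_quasi_solution_def y_def)
  note y = quasi_solutionD(1)[OF qs] and z = quasi_solutionD(2)[OF qs]
  note y_cont = quasi_solution_continuous(1)[OF qs] and z_cont = quasi_solution_continuous(2)[OF qs]
  define P where "P x = integral {0..x} (\<lambda>x. (y x)\<^sup>2)" for x
  have P: "(P has_real_derivative (y x)\<^sup>2) (at x within {0..})" if "0 \<le> x" for x
    unfolding P_def has_real_derivative_iff_has_vector_derivative
    by (rule integral_has_vector_derivative_half_line[OF _ that]) (intro continuous_intros y_cont)
  have P_nonneg: "0 \<le> P x" for x
    unfolding P_def
    by (rule integral_nonneg)
      (auto intro!: integrable_continuous_real continuous_intros continuous_on_subset[OF y_cont])
  define D where "D g x = 1 + g\<^sup>2 * P x" for g x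
  have D_pos: "1 \<le> D g x" for g x using P_nonneg by (simp add: D_def)
  have D: "(D g has_real_derivative g\<^sup>2 * (y x)\<^sup>2) (at x within {0..})" if "0 \<le> x" for g x
    unfolding D_def by (rule derivative_eq_intros P[OF that] refl)+ simp
  define h where "h g x = 2 * g\<^sup>2 * (y x)\<^sup>2 / D g x" for g x
  define h' where "h' g x = (4 * g\<^sup>2 * y x * (W x * y x + z x) * D g x - 2 * g\<^sup>2 * (y x)\<^sup>2 * (g\<^sup>2 * (y x)\<^sup>2)) / (D g x * D g x)" for g x
  have h: "(h g has_real_derivative h' g x) (at x within {0..})" if x: "0 \<le> x" for g x
    unfolding h_def[abs_def] h'_def using D_pos[of g x]
    by (auto intro!: derivative_eq_intros y[OF x] D[OF x] simp: algebra_simps)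
  have D_cont: "continuous_on {0..} (D g)" for g by (rule continuous_on_half_line_if_derivative[OF D])
  have D_ne: "D g x \<noteq> 0" for g x using D_pos[of g x] by linarith
  have h'_cont: "continuous_on {0..} (h' g)" for g
    unfolding h'_def[abs_def]
    by (intro continuous_intros y_cont z_cont D_cont cutoff_primitive_continuous[OF W]) (simp add: D_ne)
  have van: "vanishes_beyond (fst (add_bound_state \<kappa> g (V, \<theta>))) b \<longleftrightarrow> (\<forall>x>b. h' g x = 0)" for g
  proof -
    have "fst (add_bound_state \<kappa> g (V, \<theta>)) x = V x - h' g x" if x: "b < x" for x
    proof -
      have x0: "0 \<le> x" using x b by simp
      have "x \<in> interior {0..}" using x b by (simp add: interior_real_atLeast)
      then have "at x within {0..} = at x" by (rule at_within_interior)
      then have "deriv (h g) x = h' g x" using h[OF x0] by (simp add: DERIV_imp_deriv)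
      then show ?thesis
        by (simp add: add_bound_state_def h_def[abs_def] D_def P_def y_def)
    qed
    moreover have "AE x in lebesgue. b < x \<longrightarrow> V x = 0" using V_zero by (simp add: vanishes_beyond_def)
    ultimately have "vanishes_beyond (fst (add_bound_state \<kappa> g (V, \<theta>))) b \<longleftrightarrow> vanishes_beyond (h' g) b"
      unfolding vanishes_beyond_def
      by (intro iffI; elim AE_mp) (auto elim: AE_mp)
    then show ?thesis using vanishes_beyond_continuous_iff[OF h'_cont b] by simp
  qed
  have "(\<exists>g>0. \<forall>x>b. h' g x = 0) \<longleftrightarrow> z b = \<kappa> * y b \<and> 2 * \<kappa> * P b < (y b)\<^sup>2"
  proof
    assume "\<exists>g>0. \<forall>x>b. h' g x = 0"
    then obtain g where g: "0 < g" and h'0: "\<And>x. b < x \<Longrightarrow> h' g x = 0" by blast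
    have h_const: "h g x = h g b" if x: "b \<le> x" for x
    proof (rule antisym)
      show "h g x \<le> h g b" by (rule decreasing_on_half_line[OF h]) (use h'0 b x in auto)
      have "- h g x \<le> - h g b"
        by (rule decreasing_on_half_line[where f="\<lambda>x. - h g x", OF DERIV_minus[OF h]]) (use h'0 b x in auto)
      then show "h g b \<le> h g x" by simp
    qed
    \<comment> \<open>The constant value of \<open>2 * D' / D\<close> is \<open>4 * \<rho>\<close>,
      so \<open>D\<close> and \<open>y\<^sup>2\<close> grow at the rate \<open>2 * \<rho>\<close>
      and \<open>y\<close> at the rate \<open>\<rho>\<close>.\<close>
    define \<rho> where "\<rho> = h g b / 4"
    have y2_eq: "g\<^sup>2 * (y x)\<^sup>2 = 2 * \<rho> * D g x" if "b \<le> x" for x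
      using h_const[OF that] D_ne[of g x] unfolding \<rho>_def by (simp add: h_def[of g x] field_simps)
    have "0 \<le> \<rho>" using D_pos[of g b] by (simp add: \<rho>_def h_def)
    have z_eq: "4 * g\<^sup>2 * y x * z x = 4 * \<rho> * g\<^sup>2 * (y x)\<^sup>2" if x: "b < x" for x
    proof -
      have x0: "0 \<le> x" using x b by simp
      have "((\<lambda>x. 2 * (g\<^sup>2 * (y x)\<^sup>2 - 2 * \<rho> * D g x)) has_real_derivative
          4 * g\<^sup>2 * y x * z x - 4 * \<rho> * g\<^sup>2 * (y x)\<^sup>2) (at x within {0..})"
        by (rule derivative_eq_intros y[OF x0] D[OF x0] refl)+ (use W_zero[of x] x in \<open>simp add: algebra_simps\<close>)
      then have "4 * g\<^sup>2 * y x * z x - 4 * \<rho> * g\<^sup>2 * (y x)\<^sup>2 = 0"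
        by (rule derivative_zero_if_constant_beyond[OF _ b x, of _ _ 0]) (use y2_eq in simp)
      then show ?thesis by simp
    qed
    define x1 where "x1 = b + 1"
    have x1: "b < x1" "0 \<le> x1" using b by (auto simp: x1_def)
    \<comment> \<open>Otherwise \<open>y\<close> would vanish on a whole ray, together with its
      derivative.\<close>
    have "\<rho> \<noteq> 0"
    proof
      assume "\<rho> = 0"
      then have y0: "y x = 0" if "b \<le> x" for x using y2_eq[OF that] g by simp
      have "W x1 * y x1 + z x1 = 0"
        by (rule derivative_zero_if_constant_beyond[OF y[OF x1(2)] b x1(1) y0])
      then show False
        using regular_quasi_solution_nontrivial[OF W yz x1(2)] y0[of x1] x1 by (simp add: y_def)
    qed
    then have \<rho>: "0 < \<rho>" using \<open>0 \<le> \<rho>\<close> by simp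
    have y_ne: "y x \<noteq> 0" if "b \<le> x" for x
      using y2_eq[OF that] \<rho> D_ne[of g x] by auto
    have z_prop: "z x = \<rho> * y x" if x: "b < x" for x
      using z_eq[OF x] y_ne[of x] x g by (simp add: power2_eq_square)
    \<comment> \<open>The relation \<open>z = \<rho> y\<close> is known strictly beyond
      \<open>b\<close>, hence on the closed ray from \<open>x1\<close>; differentiating it at a
      point beyond \<open>x1\<close> gives \<open>\<kappa>\<^sup>2 = \<rho>\<^sup>2\<close>.\<close>
    define x2 where "x2 = x1 + 1"
    have x2: "x1 < x2" "b < x2" "0 \<le> x2" using x1 by (auto simp: x2_def)
    have "((\<lambda>x. z x - \<rho> * y x) has_real_derivative \<kappa>\<^sup>2 * y x2 - \<rho> * z x2) (at x2 within {0..})"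
      by (rule derivative_eq_intros y[OF x2(3)] z[OF x2(3)] refl)+ (use W_zero[of x2] x2 in simp)
    then have "\<kappa>\<^sup>2 * y x2 - \<rho> * z x2 = 0"
      by (rule derivative_zero_if_constant_beyond[OF _ x1(2) x2(1), of _ _ 0]) (use z_prop x1 in simp)
    then have "\<kappa>\<^sup>2 = \<rho>\<^sup>2"
      using z_prop[OF x2(2)] y_ne[of x2] x2 by (simp add: power2_eq_square)
    then have \<rho>\<kappa>: "\<rho> = \<kappa>" using \<rho> \<kappa> by (simp add: power2_eq_iff_nonneg)
    \<comment> \<open>Constancy of the Wronskian with \<open>exp (\<kappa> * x)\<close> carries the
      relation from \<open>x1\<close> back to \<open>b\<close>.\<close>
    have "exp (- (- \<kappa> * x1)) * (z x1 + - \<kappa> * y x1) = exp (- (- \<kappa> * b)) * (z b + - \<kappa> * y b)"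
      using decaying_component_constant[OF W, of "- \<kappa>" y z x1] qs x1 by simp
    then have zb: "z b = \<kappa> * y b" using z_prop[OF x1(1)] \<rho>\<kappa> by simp
    have "g\<^sup>2 * ((y b)\<^sup>2 - 2 * \<kappa> * P b) = 2 * \<kappa>"
      using y2_eq[of b] unfolding \<rho>\<kappa> D_def by (simp add: algebra_simps)
    then have "0 < g\<^sup>2 * ((y b)\<^sup>2 - 2 * \<kappa> * P b)" using \<kappa> by simp
    then have "2 * \<kappa> * P b < (y b)\<^sup>2" by (simp add: zero_less_mult_iff)
    then show "z b = \<kappa> * y b \<and> 2 * \<kappa> * P b < (y b)\<^sup>2" using zb by simp
  next
    assume *: "z b = \<kappa> * y b \<and> 2 * \<kappa> * P b < (y b)\<^sup>2"
    define Q where "Q = (y b)\<^sup>2 - 2 * \<kappa> * P b"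
    have Q: "0 < Q" using * by (simp add: Q_def)
    define g where "g = sqrt (2 * \<kappa> / Q)"
    have g: "0 < g" "g\<^sup>2 * Q = 2 * \<kappa>" using Q \<kappa> by (auto simp: g_def)
    have z_prop: "z x = \<kappa> * y x" if "b \<le> x" for x
      using exponential_beyond_cutoff(1)[OF W, of "- \<kappa>" y z x] qs * that by simp
    have y2_eq: "g\<^sup>2 * (y x)\<^sup>2 - 2 * \<kappa> * D g x = 0" if x: "b \<le> x" for x
    proof -
      have "g\<^sup>2 * (y x)\<^sup>2 - 2 * \<kappa> * D g x = g\<^sup>2 * (y b)\<^sup>2 - 2 * \<kappa> * D g b"
      proof (rule constant_on_ray[of b "\<lambda>x. g\<^sup>2 * (y x)\<^sup>2 - 2 * \<kappa> * D g x", OF _ b x])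
        fix x assume x: "b \<le> x"
        then have x0: "0 \<le> x" using b by simp
        show "((\<lambda>x. g\<^sup>2 * (y x)\<^sup>2 - 2 * \<kappa> * D g x) has_real_derivative 0) (at x within {0..})"
          by (rule derivative_eq_intros y[OF x0] D[OF x0] refl)+
            (simp add: W_zero[OF x] z_prop[OF x] power2_eq_square)
      qed
      also have "\<dots> = 0" using g(2) by (simp add: D_def Q_def algebra_simps)
      finally show ?thesis .
    qed
    have "h g x = 4 * \<kappa>" if "b \<le> x" for x
      using y2_eq[OF that] D_ne[of g x] by (simp add: h_def field_simps)
    then have "h' g x = 0" if "b < x" for x
      using derivative_zero_if_constant_beyond[OF h b that, of g "4 * \<kappa>"] b that by simp
    then show "\<exists>g>0. \<forall>x>b. h' g x = 0" using g(1) by blast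
  qed
  then show ?thesis unfolding van by (simp add: P_def y_def)
qed

text \<open>As \<open>f\<close> vanishes at \<open>x\<close>, the difference quotient of the product
  is \<open>P\<close> times that of \<open>f\<close>, so continuity of \<open>P\<close> suffices.
  Here \<open>P\<close> will be the rational factor produced by the Darboux steps.\<close>

lemma derivative_product_at_zero:
  fixes f P :: "real \<Rightarrow> real"
  assumes f: "(f has_real_derivative d) (at x)" "f x = 0" and P: "isCont P x"
  shows "((\<lambda>t. P t * f t) has_real_derivative P x * d) (at x)"
proof -
  obtain k where k: "\<And>t. f t - f x = k t * (t - x)" "isCont k x" "k x = d"
    using f(1) unfolding CARAT_DERIV by blast
  show ?thesis
    unfolding CARAT_DERIV
  proof (intro exI[of _ "\<lambda>t. P t * k t"] conjI allI)
    show "isCont (\<lambda>t. P t * k t) x" by (intro continuous_intros P k(2))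
    show "P t * f t - P x * f x = P t * k t * (t - x)" for t
      using k(1)[of t] f(2) by simp
  qed (simp add: k(3))
qed

theorem theorem3p10:
  fixes j :: nat and V V0 :: "real \<Rightarrow> real" and \<theta> \<theta>0 b :: real and \<gamma> :: "nat \<Rightarrow> real"
  assumes "V \<in> class_A" and "0 < \<theta>" and "\<theta> \<le> pi"
    and "0 \<le> b" and "vanishes_beyond V b"
    and "inj_on \<gamma> {1..j}"
    and "bound_states V \<theta> = (\<lambda>s. \<i> * complex_of_real (\<gamma> s)) ` {1..j}"
    and "remove_bound_states \<gamma> j (V, \<theta>) = (V0, \<theta>0)"
    and "0 < \<gamma> (j + 1)" and "\<forall>s\<in>{1..j}. \<gamma> (j + 1) \<noteq> \<gamma> s"
  shows "(\<exists>g>0. vanishes_beyond (fst (add_bound_state (\<gamma> (j + 1)) g (V, \<theta>))) b) \<longleftrightarrow>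
    jost_H V0 \<theta>0 (- \<gamma> (j + 1)) = 0 \<and>
    (\<exists>d>0. (jost_H V0 \<theta>0 has_vector_derivative complex_of_real d) (at (- \<gamma> (j + 1))))"
proof -
  define \<kappa> where "\<kappa> = \<gamma> (j + 1)"
  have \<kappa>: "0 < \<kappa>" using assms(9) by (simp add: \<kappa>_def)
  obtain W where W: "cutoff_primitive V b W" using cutoff_primitive_exists[OF assms(1,4,5)] by blast
  have \<gamma>_pos: "0 < \<gamma> s" if "s \<in> {1..j}" for s
  proof -
    have "\<i> * complex_of_real (\<gamma> s) \<in> bound_states V \<theta>" using that assms(7) by blast
    then show ?thesis by (simp add: bound_states_def)
  qed
  have zeros: "jost_H V \<theta> \<beta> = 0 \<longleftrightarrow> \<beta> \<in> \<gamma> ` {1..j}" if \<beta>: "0 < \<beta>" for \<beta>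
  proof -
    have "jost_H V \<theta> \<beta> = 0 \<longleftrightarrow> \<i> * complex_of_real \<beta> \<in> bound_states V \<theta>"
      using \<beta> by (simp add: jost_H_def bound_states_def)
    also have "\<dots> \<longleftrightarrow> \<beta> \<in> \<gamma> ` {1..j}" unfolding assms(7) by auto
    finally show ?thesis .
  qed
  define P where "P \<beta> = (\<Prod>s\<in>{1..j}. (\<beta> + \<gamma> s) / (\<beta> - \<gamma> s))" for \<beta>
  note spec = remove_bound_states_spec[OF W assms(2,3,6) \<gamma>_pos zeros assms(8)]
  obtain W0 where W0: "cutoff_primitive V0 b W0" using spec by blast
  have no_zeros: "jost_H V0 \<theta>0 \<beta> \<noteq> 0" if "0 < \<beta>" for \<beta> using spec that by blast
  have factor: "jost_H V0 \<theta>0 \<beta> = of_real (P \<beta>) * jost_H V \<theta> \<beta>"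
    if "\<And>s. s \<in> {1..j} \<Longrightarrow> \<beta> \<noteq> \<gamma> s \<and> \<beta> \<noteq> - \<gamma> s" for \<beta>
    using spec that unfolding P_def by blast
  have \<kappa>_ne: "\<kappa> \<noteq> \<gamma> s \<and> \<kappa> \<noteq> - \<gamma> s \<and> - \<kappa> \<noteq> \<gamma> s \<and> - \<kappa> \<noteq> - \<gamma> s" if "s \<in> {1..j}" for s
    using assms(10) that \<gamma>_pos[OF that] \<kappa> by (auto simp: \<kappa>_def)
  have PP: "P (- \<kappa>) * P \<kappa> = 1"
    unfolding P_def prod.distrib[symmetric]
  proof (rule prod.neutral, rule ballI)
    fix s assume "s \<in> {1..j}"
    from \<kappa>_ne[OF this] have "\<kappa> + \<gamma> s \<noteq> 0" "\<kappa> - \<gamma> s \<noteq> 0" "- \<kappa> - \<gamma> s \<noteq> 0" by auto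
    moreover have "(- \<kappa> + \<gamma> s) / (- \<kappa> - \<gamma> s) = (\<kappa> - \<gamma> s) / (\<kappa> + \<gamma> s)"
      using minus_divide_divide[of "\<kappa> - \<gamma> s" "\<kappa> + \<gamma> s"] by simp
    ultimately show "(- \<kappa> + \<gamma> s) / (- \<kappa> - \<gamma> s) * ((\<kappa> + \<gamma> s) / (\<kappa> - \<gamma> s)) = 1" by simp
  qed
  define y where "y = phi V \<theta> \<kappa>"
  obtain z where yz: "regular_quasi_solution W \<theta> \<kappa> y z"
    using phi_regular_quasi_solution[OF W] unfolding y_def by blast
  then have yz': "regular_quasi_solution W \<theta> (- \<kappa>) y z" by (simp add: regular_quasi_solution_def)
  define Q where "Q = (y b)\<^sup>2 - 2 * \<kappa> * integral {0..b} (\<lambda>x. (y x)\<^sup>2)"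
  have zero_iff: "jost_H V0 \<theta>0 (- \<kappa>) = 0 \<longleftrightarrow> z b = \<kappa> * y b"
  proof -
    have "P (- \<kappa>) \<noteq> 0" using PP by auto
    then have "jost_H V0 \<theta>0 (- \<kappa>) = 0 \<longleftrightarrow> jost_H V \<theta> (- \<kappa>) = 0"
      using factor[of "- \<kappa>"] \<kappa>_ne by simp
    then show ?thesis using jost_H_zero_iff[OF W yz'] by simp
  qed
  have der_iff: "(\<exists>d>0. (jost_H V0 \<theta>0 has_vector_derivative complex_of_real d) (at (- \<kappa>))) \<longleftrightarrow> 0 < Q"
    if zb: "z b = \<kappa> * y b"
  proof -
    have H_zero: "jost_H V \<theta> (- \<kappa>) = 0" using jost_H_zero_iff[OF W yz'] zb by simp
    note yb = jost_H_derivative_at_zero(1)[OF W yz' H_zero]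
    define d where "d = P (- \<kappa>) * (exp (\<kappa> * b) / y b * Q)"
    have "((\<lambda>\<beta>. Re (jost_H V \<theta> \<beta>)) has_real_derivative exp (\<kappa> * b) / y b * Q) (at (- \<kappa>))"
      using jost_H_derivative_at_zero(2)[OF W yz' H_zero] by (simp add: Q_def)
    moreover have "isCont P (- \<kappa>)"
      unfolding P_def using \<kappa>_ne by (intro continuous_intros) force
    ultimately have der: "((\<lambda>\<beta>. P \<beta> * Re (jost_H V \<theta> \<beta>)) has_real_derivative d) (at (- \<kappa>))"
      unfolding d_def using H_zero by (intro derivative_product_at_zero) auto
    \<comment> \<open>The factorisation of \<open>jost_H V0 \<theta>0\<close> is available off
      finitely many points, hence on a neighbourhood of \<open>- \<kappa>\<close>, which is enough
      to transfer the derivative.\<close>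
    define U where "U = - (\<gamma> ` {1..j} \<union> (\<lambda>s. - \<gamma> s) ` {1..j})"
    have "open U" unfolding U_def by (intro open_Compl finite_imp_closed) auto
    moreover have "- \<kappa> \<in> U" unfolding U_def using \<kappa>_ne by blast
    moreover have "P \<beta> * Re (jost_H V \<theta> \<beta>) = Re (jost_H V0 \<theta>0 \<beta>)" if "\<beta> \<in> U" for \<beta>
    proof -
      have "\<beta> \<noteq> \<gamma> s \<and> \<beta> \<noteq> - \<gamma> s" if "s \<in> {1..j}" for s
        using \<open>\<beta> \<in> U\<close> that unfolding U_def by blast
      from factor[OF this] show ?thesis by simp
    qed
    ultimately have "((\<lambda>\<beta>. Re (jost_H V0 \<theta>0 \<beta>)) has_real_derivative d) (at (- \<kappa>))"
      by (intro has_field_derivative_transform_within_open[OF der])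
    then have "((\<lambda>\<beta>. complex_of_real (Re (jost_H V0 \<theta>0 \<beta>))) has_vector_derivative complex_of_real d) (at (- \<kappa>))"
      by (rule has_vector_derivative_of_real)
    then have vd: "(jost_H V0 \<theta>0 has_vector_derivative complex_of_real d) (at (- \<kappa>))"
      by (simp only: jost_H_real[OF W0, symmetric])
    have "0 < Re (jost_H V0 \<theta>0 \<kappa>)"
      by (rule jost_H_positive_if_no_zeros[OF W0 no_zeros \<kappa>])
    also have "Re (jost_H V0 \<theta>0 \<kappa>) = P \<kappa> * (exp (- (\<kappa> * b)) * (2 * \<kappa> * y b))"
      using factor[of \<kappa>] \<kappa>_ne unfolding jost_H_eq[OF W yz] zb by simp
    finally have pos: "0 < P \<kappa> * (exp (- (\<kappa> * b)) * (2 * \<kappa> * y b))" .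
    have "d * (P \<kappa> * (exp (- (\<kappa> * b)) * (2 * \<kappa> * y b))) =
        (P (- \<kappa>) * P \<kappa>) * (exp (\<kappa> * b) * exp (- (\<kappa> * b))) * (2 * \<kappa>) * Q"
      using yb by (simp add: d_def)
    also have "\<dots> = 2 * \<kappa> * Q" by (simp only: PP exp_minus_inverse mult_1)
    finally have "0 < d \<longleftrightarrow> 0 < Q"
      using pos \<kappa> by (metis zero_less_mult_iff zero_less_mult_pos2 zero_less_numeral)
    \<comment> \<open>Uniqueness of the derivative reduces the existential statement to the sign of
      this particular \<open>d\<close>.\<close>
    moreover have "d' = d" if "(jost_H V0 \<theta>0 has_vector_derivative complex_of_real d') (at (- \<kappa>))" for d'
      using vector_derivative_unique_at[OF that vd] by simp
    ultimately show ?thesis using vd by blast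
  qed
  have "(\<exists>g>0. vanishes_beyond (fst (add_bound_state \<kappa> g (V, \<theta>))) b) \<longleftrightarrow> z b = \<kappa> * y b \<and> 0 < Q"
    using add_bound_state_vanishes_beyond_iff[OF W \<kappa> yz[unfolded y_def]] by (simp add: Q_def y_def)
  then show ?thesis
    unfolding \<kappa>_def[symmetric] using zero_iff der_iff by blast
qed

end
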